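(* Let $\Delta_n$ denote the maximum degree of a graph drawn uniformly at random from the graphs in $\mathrm{Ex}(C_7)$ with $n$ vertices. Then there is a constant $C>0$ such that $$\Delta_n \le C\frac{\log n}{\log\log\log\log n}\qquad\text{w.h.p.}$$
   Context: All graphs are labelled. $\mathrm{Ex}(C_7)$ is the class of labelled graphs not containing the 7-cycle $C_7$ as a minor; a random graph of size $n$ is drawn uniformly from the graphs in the class on vertex set $\{1,\dots,n\}$. An event holds with high probability (w.h.p.) if its probability tends to $1$ as $n\to\infty$. $\log$ is the natural logarithm. *)

theory Defs
  imports "HOL-Probability.Probability"
begin

type_synonym 'a graph = "'a set \<times> 'a set set"

abbreviation verts :: "'a graph \<Rightarrow> 'a set" where
  "verts \<equiv> fst"

abbreviation edges :: "'a graph \<Rightarrow> 'a set set" where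
  "edges \<equiv> snd"

definition simple_graph :: "'a graph \<Rightarrow> bool" where
  "simple_graph G \<longleftrightarrow> finite (verts G) \<and> (\<forall>e\<in>edges G. e \<subseteq> verts G \<and> card e = 2)"

definition vertex_degree :: "'a graph \<Rightarrow> 'a \<Rightarrow> nat" where
  "vertex_degree G v = card {w \<in> verts G. {v, w} \<in> edges G}"

definition max_degree :: "'a graph \<Rightarrow> nat" where
  "max_degree G = Max (vertex_degree G ` verts G)"

definition induces_connected :: "'a graph \<Rightarrow> 'a set \<Rightarrow> bool" where
  "induces_connected G S \<longleftrightarrow> S \<noteq> {} \<and> S \<subseteq> verts G \<and>
     (\<forall>u\<in>S. \<forall>v\<in>S. (u, v) \<in> {(x, y). x \<in> S \<and> y \<in> S \<and> {x, y} \<in> edges G}\<^sup>*)"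

text \<open>\<^term>\<open>H\<close> is (isomorphic to) a minor of \<^term>\<open>G\<close>: contracting the pairwise disjoint
  connected branch sets \<^term>\<open>B h\<close> to single vertices, and deleting superfluous vertices and edges,
  turns \<^term>\<open>G\<close> into a copy of \<^term>\<open>H\<close>.\<close>

definition is_minor :: "'b graph \<Rightarrow> 'a graph \<Rightarrow> bool" where
  "is_minor H G \<longleftrightarrow> (\<exists>B.
     (\<forall>h\<in>verts H. induces_connected G (B h)) \<and>
     disjoint_family_on B (verts H) \<and>
     (\<forall>h k. {h, k} \<in> edges H \<longrightarrow> (\<exists>x\<in>B h. \<exists>y\<in>B k. {x, y} \<in> edges G)))"

text \<open>The cycle of length \<^term>\<open>k\<close>, meaningful for \<^term>\<open>k \<ge> 3\<close>.\<close>

definition cycle_graph :: "nat \<Rightarrow> nat graph" where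
  "cycle_graph k = ({..<k}, {{i, (i + 1) mod k} | i. i < k})"

definition excluded_minor_graphs :: "'b graph \<Rightarrow> nat \<Rightarrow> nat graph set" where
  "excluded_minor_graphs H n = {G. simple_graph G \<and> verts G = {1..n} \<and> \<not> is_minor H G}"

text \<open>The next two facts ensure that the uniform distribution on
  \<^term>\<open>excluded_minor_graphs (cycle_graph 7) n\<close> given by \<^const>\<open>pmf_of_set\<close> is the intended one.\<close>

lemma finite_excluded_minor_graphs: "finite (excluded_minor_graphs H n)"
proof (rule finite_subset)
  show "excluded_minor_graphs H n \<subseteq> {{1..n}} \<times> Pow (Pow {1..n})"
    unfolding excluded_minor_graphs_def simple_graph_def by fastforce
qed simp

lemma excluded_minor_graphs_cycle_nonempty: "excluded_minor_graphs (cycle_graph 7) n \<noteq> {}"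
proof -
  have "{0, 1} \<in> edges (cycle_graph 7)"
    unfolding cycle_graph_def by (force intro: exI[of _ 0])
  then have "({1..n}, {}) \<in> excluded_minor_graphs (cycle_graph 7) n"
    by (auto simp: excluded_minor_graphs_def simple_graph_def is_minor_def)
  then show ?thesis by blast
qed

end

theory Submission
  imports Defs "HOL-Real_Asymp.Real_Asymp"
begin

text \<open>
  A graph has no \<open>C\<^sub>7\<close> minor iff all its cycles have length at most 6. Fix a vertex \<open>v\<close> and let \<open>W\<close> be
  the set of the \<open>N\<close> other vertices of the blocks at \<open>v\<close>. Deleting the edges of these blocks
  and attaching each \<open>w \<in> W\<close> by a new bridge to an arbitrary vertex of another component
  yields about \<open>n ^ N\<close> graphs of the class. Since graphs of the class have at most \<open>5 n\<close> edges, a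
  graph arises in at most \<open>(10 n) ^ N / N!\<close> ways, times the number of possible block graphs on
  \<open>{v} \<union> W\<close>. So it suffices to count block graphs in which \<open>v\<close> has degree at least \<open>D\<close>.

  Call the neighbours of \<open>v\<close> marked. A path between marked vertices avoiding \<open>v\<close> has at most 5
  vertices, and deleting the longest such path from a connected set leaves components in which
  these paths have at most 3, then at most 1 vertices. Hence the block graph has an elimination
  tree of bounded depth in which the marks are nested only three levels deep. A tree in which \<open>s\<close>
  has \<open>c\<^sub>s\<close> children is one of at most \<open>N! / \<Prod> c\<^sub>s!\<close> trees with these numbers of children, and
  \<open>R ^ c / c! \<le> exp R\<close> gains one exponential per level: the number of block graphs is at most
  \<open>N! K ^ (- N) u ^ (- D) exp (exp (exp (O (u))))\<close> for every fixed \<open>K\<close> and all \<open>u \<ge> 1\<close>. With \<open>u\<close>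
  of order \<open>ln (ln (ln n))\<close> the triple exponential is of order \<open>n\<close>, while \<open>u ^ (- D)\<close> is
  smaller than any fixed power of \<open>1 / n\<close> once \<open>D\<close> is a large multiple of
  \<open>ln n / ln (ln (ln (ln n)))\<close>.
\<close>

section \<open>Paths, cycles and the seven-cycle minor\<close>

definition gpath :: "'a set set \<Rightarrow> 'a list \<Rightarrow> bool" where
  "gpath E xs \<longleftrightarrow> distinct xs \<and> successively (\<lambda>x y. {x, y} \<in> E) xs"

text \<open>From three vertices on, the closing pair turns the path into a cycle; an empty list, a
  vertex or a single edge read as a closed path satisfies the bound trivially.\<close>

definition short_cycles :: "'a set set \<Rightarrow> bool" where
  "short_cycles E \<longleftrightarrow> (\<forall>xs. gpath E xs \<and> {last xs, hd xs} \<in> E \<longrightarrow> length xs \<le> 6)"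

definition restr :: "'a set set \<Rightarrow> 'a set \<Rightarrow> ('a \<times> 'a) set" where
  "restr E S = {(x, y). x \<in> S \<and> y \<in> S \<and> {x, y} \<in> E}"

lemma gpath_Nil [simp]: "gpath E []"
  by (simp add: gpath_def)

lemma gpath_Cons:
  "gpath E (x # xs) \<longleftrightarrow> x \<notin> set xs \<and> gpath E xs \<and> (xs = [] \<or> {x, hd xs} \<in> E)"
  by (auto simp: gpath_def successively_Cons)

lemma gpath_append:
  "gpath E (xs @ ys) \<longleftrightarrow> gpath E xs \<and> gpath E ys \<and> set xs \<inter> set ys = {} \<and>
     (xs = [] \<or> ys = [] \<or> {last xs, hd ys} \<in> E)"
  by (auto simp: gpath_def successively_append_iff)

lemma gpath_rev [simp]: "gpath E (rev xs) \<longleftrightarrow> gpath E xs"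
  by (simp add: gpath_def insert_commute)

lemma gpath_distinct: "gpath E xs \<Longrightarrow> distinct xs"
  by (simp add: gpath_def)

lemma gpath_mono: "gpath E xs \<Longrightarrow> E \<subseteq> F \<Longrightarrow> gpath F xs"
  unfolding gpath_def by (auto elim: successively_mono)

lemma short_cycles_mono: "short_cycles F \<Longrightarrow> E \<subseteq> F \<Longrightarrow> short_cycles E"
  unfolding short_cycles_def using gpath_mono by blast

lemma short_cyclesD: "short_cycles E \<Longrightarrow> gpath E xs \<Longrightarrow> {last xs, hd xs} \<in> E \<Longrightarrow> length xs \<le> 6"
  by (simp add: short_cycles_def)

lemma restr_sym: "(x, y) \<in> restr E S \<Longrightarrow> (y, x) \<in> restr E S"
  by (auto simp: restr_def insert_commute)

lemma restr_rtrancl_sym: "(x, y) \<in> (restr E S)\<^sup>* \<Longrightarrow> (y, x) \<in> (restr E S)\<^sup>*"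
  by (metis restr_sym symI sym_rtrancl symD)

lemma restr_mono: "E \<subseteq> F \<Longrightarrow> S \<subseteq> T \<Longrightarrow> restr E S \<subseteq> restr F T"
  by (auto simp: restr_def)

lemma restr_rtrancl_mono: "(x, y) \<in> (restr E S)\<^sup>* \<Longrightarrow> E \<subseteq> F \<Longrightarrow> S \<subseteq> T \<Longrightarrow> (x, y) \<in> (restr F T)\<^sup>*"
  by (meson restr_mono rtrancl_mono subsetD)

lemma gpath_connects:
  assumes "gpath E p" "set p \<subseteq> S" "x \<in> set p" "y \<in> set p"
  shows "(x, y) \<in> (restr E S)\<^sup>*"
proof -
  have *: "(hd p, z) \<in> (restr E S)\<^sup>*" if "gpath E p" "set p \<subseteq> S" "z \<in> set p" for p z
    using that
  proof (induction p)
    case (Cons a p)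
    show ?case
    proof (cases "z = a")
      case False
      then have z: "z \<in> set p" using Cons.prems by simp
      then have "p \<noteq> []" by auto
      then have "(a, hd p) \<in> restr E S"
        using Cons.prems by (auto simp: gpath_Cons restr_def)
      moreover have "(hd p, z) \<in> (restr E S)\<^sup>*"
        using Cons z by (auto simp: gpath_Cons)
      ultimately show ?thesis by (simp add: converse_rtrancl_into_rtrancl)
    qed simp
  qed simp
  show ?thesis
    using *[OF assms(1,2,3)] *[OF assms(1,2,4)] restr_rtrancl_sym by (metis rtrancl_trans)
qed

text \<open>A walk is shortened to a path while it is built: if the new first vertex already occurs,
  everything before this occurrence is cut off.\<close>

lemma connects_gpath:
  assumes "(x, y) \<in> (restr E S)\<^sup>*" "x \<in> S"
  obtains p where "gpath E p" "p \<noteq> []" "set p \<subseteq> S" "hd p = x" "last p = y"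
proof -
  have "\<exists>p. gpath E p \<and> p \<noteq> [] \<and> set p \<subseteq> S \<and> hd p = x \<and> last p = y"
    using assms
  proof (induction rule: converse_rtrancl_induct)
    case base
    then show ?case by (intro exI[of _ "[y]"]) (auto simp: gpath_Cons)
  next
    case (step x z)
    then obtain p where p: "gpath E p" "p \<noteq> []" "set p \<subseteq> S" "hd p = z" "last p = y"
      by (auto simp: restr_def)
    show ?case
    proof (cases "x \<in> set p")
      case True
      then obtain a b where "p = a @ x # b" by (meson split_list)
      then show ?thesis using p by (intro exI[of _ "x # b"]) (auto simp: gpath_append)
    next
      case False
      then show ?thesis using p step.hyps
        by (intro exI[of _ "x # p"]) (auto simp: gpath_Cons restr_def)
    qed
  qed
  then show ?thesis using that by blast
qed

lemma restr_rtrancl_in: "(x, y) \<in> (restr E S)\<^sup>* \<Longrightarrow> x \<in> S \<Longrightarrow> y \<in> S"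
  by (induction rule: rtrancl_induct) (auto simp: restr_def)

section \<open>Absence of a 7-cycle minor as a bound on cycle lengths\<close>

lemma cycle_edges_nat7:
  assumes "{h, k} \<in> edges (cycle_graph 7)"
  shows "(h < 7 \<and> k = (h + 1) mod 7) \<or> (k < 7 \<and> h = (k + 1) mod 7)"
  using assms by (auto simp: cycle_graph_def doubleton_eq_iff)

text \<open>In a model of the 7-cycle, each branch set contributes a nonempty path from the point
  where the edge from the preceding branch set enters to the point where the edge to the next one
  leaves. Joined by the seven edges, these paths form a cycle with at least seven vertices.\<close>

lemma short_cycles_imp_not_minor:
  assumes "short_cycles E"
  shows "\<not> is_minor (cycle_graph 7) (V, E)"
proof
  assume "is_minor (cycle_graph 7) (V, E)"
  then obtain B where B: "\<And>h. h < 7 \<Longrightarrow> induces_connected (V, E) (B h)"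
    and disj: "disjoint_family_on B {..<7}"
    and e: "\<And>h k. {h, k} \<in> edges (cycle_graph 7) \<Longrightarrow> \<exists>x\<in>B h. \<exists>y\<in>B k. {x, y} \<in> E"
    unfolding is_minor_def by (auto simp: cycle_graph_def)
  have "\<exists>x\<in>B i. \<exists>y\<in>B ((i + 1) mod 7). {x, y} \<in> E" if "i < 7" for i
  proof -
    have "{i, (i + 1) mod 7} \<in> edges (cycle_graph 7)"
      using that by (auto simp: cycle_graph_def)
    then show ?thesis by (rule e)
  qed
  then obtain x y where xy: "\<And>i. i < 7 \<Longrightarrow> x i \<in> B i" "\<And>i. i < 7 \<Longrightarrow> y i \<in> B ((i + 1) mod 7)"
    "\<And>i. i < 7 \<Longrightarrow> {x i, y i} \<in> E"
    by (simp only: Bex_def) metis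
  \<comment> \<open>\<open>(i + 6) mod 7\<close> is the cyclic predecessor of
    \<open>i\<close>.\<close>
  have "\<forall>i. \<exists>p. i < 7 \<longrightarrow> gpath E p \<and> p \<noteq> [] \<and> set p \<subseteq> B i \<and> hd p = y ((i + 6) mod 7) \<and> last p = x i"
  proof
    fix i :: nat
    show "\<exists>p. i < 7 \<longrightarrow> gpath E p \<and> p \<noteq> [] \<and> set p \<subseteq> B i \<and> hd p = y ((i + 6) mod 7) \<and> last p = x i"
    proof (cases "i < 7")
      case that: True
    have y: "y ((i + 6) mod 7) \<in> B i"
    proof -
      have "((i + 6) mod 7 + 1) mod 7 = i" using that by presburger
      then show ?thesis using xy(2)[of "(i + 6) mod 7"] by simp
    qed
    have "(y ((i + 6) mod 7), x i) \<in> (restr E (B i))\<^sup>*"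
      using B[OF that] y xy(1)[OF that] by (auto simp: induces_connected_def restr_def)
    with y obtain p where "gpath E p" "p \<noteq> []" "set p \<subseteq> B i" "hd p = y ((i + 6) mod 7)" "last p = x i"
      using connects_gpath by metis
    then show ?thesis by blast
    qed simp
  qed
  from choice[OF this] obtain p where p: "\<And>i. i < 7 \<Longrightarrow> gpath E (p i)" "\<And>i. i < 7 \<Longrightarrow> p i \<noteq> []"
    "\<And>i. i < 7 \<Longrightarrow> set (p i) \<subseteq> B i" "\<And>i. i < 7 \<Longrightarrow> hd (p i) = y ((i + 6) mod 7)"
    "\<And>i. i < 7 \<Longrightarrow> last (p i) = x i"
    by blast
  have dj: "set (p i) \<inter> set (p j) = {}" if "i < 7" "j < 7" "i \<noteq> j" for i j
    using p(3)[OF that(1)] p(3)[OF that(2)] disj that by (fastforce simp: disjoint_family_on_def)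
  have hp: "hd (p 0) = y 6" "\<And>i. 0 < i \<Longrightarrow> i < 7 \<Longrightarrow> hd (p i) = y (i - 1)"
    using p(4)[of 0] apply simp
    subgoal for i using p(4)[of i] by (cases i) auto
    done
  define f where "f k = concat (map p [0..<k])" for k
  have f: "gpath E (f k) \<and> length (f k) \<ge> k \<and> set (f k) = (\<Union>i<k. set (p i)) \<and>
      (k > 0 \<longrightarrow> f k \<noteq> [] \<and> hd (f k) = y 6 \<and> last (f k) = x (k - 1))" if "k \<le> 7" for k
    using that
  proof (induction k)
    case 0
    then show ?case by (simp add: f_def)
  next
    case (Suc k)
    have fS: "f (Suc k) = f k @ p k" by (simp add: f_def)
    have "length (p k) \<ge> 1" using p(2)[of k] Suc.prems by (cases "p k") auto
    moreover have "set (f k) \<inter> set (p k) = {}" 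
    proof -
      have "set (f k) = (\<Union>i<k. set (p i))" using Suc by simp
      moreover have "set (p i) \<inter> set (p k) = {}" if "i < k" for i
        using dj[of i k] that Suc.prems by simp
      ultimately show ?thesis by auto
    qed
    moreover have "k = 0 \<and> f k = [] \<or> k > 0 \<and> {last (f k), hd (p k)} \<in> E \<and> f k \<noteq> []"
      using Suc hp(2)[of k] xy(3)[of "k - 1"] by (cases "k = 0") (auto simp: f_def)
    ultimately show ?case
      using Suc p(1)[of k] p(2)[of k] p(5)[of k] hp(1)
      by (auto simp: fS gpath_append lessThan_Suc)
  qed
  have "length (f 7) \<le> 6"
    using f[of 7] xy(3)[of 6] assms by (intro short_cyclesD) auto
  then show False using f[of 7] by simp
qed

text \<open>The first six vertices of a longer cycle serve as singleton branch sets, and the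
  remaining vertices, which form a path, as the seventh.\<close>

lemma not_minor_imp_short_cycles:
  assumes sg: "simple_graph (V, E)" and "\<not> is_minor (cycle_graph 7) (V, E)"
  shows "short_cycles E"
proof (rule ccontr)
  assume "\<not> short_cycles E"
  then obtain xs where xs: "gpath E xs" "{last xs, hd xs} \<in> E" "length xs \<ge> 7"
    by (force simp: short_cycles_def)
  have d: "distinct xs" using xs(1) by (rule gpath_distinct)
  have sub: "set xs \<subseteq> V"
  proof
    fix z assume "z \<in> set xs"
    then obtain i where i: "i < length xs" "z = xs ! i" by (auto simp: in_set_conv_nth)
    have "\<exists>e\<in>E. z \<in> e"
    proof (cases "Suc i < length xs")
      case True
      then show ?thesis using xs(1) i by (metis gpath_def successively_nth insertI1)
    next
      case False
      then have "z = last xs" using i by (cases xs rule: rev_cases) (auto simp: nth_append less_Suc_eq)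
      then show ?thesis using xs(2) by blast
    qed
    then show "z \<in> V" using sg by (auto simp: simple_graph_def)
  qed
  define B where "B i = (if i < 6 then {xs ! i} else set (drop 6 xs))" for i :: nat
  have B: "induces_connected (V, E) (B h)" if "h < 7" for h
  proof (cases "h < 6")
    case True
    then show ?thesis using xs(3) sub by (auto simp: induces_connected_def B_def)
  next
    case False
    have g: "gpath E (drop 6 xs)" using xs(1) by (metis append_take_drop_id gpath_append)
    have "set (drop 6 xs) \<subseteq> V" using sub by (meson set_drop_subset subset_trans)
    moreover have "drop 6 xs \<noteq> []" using xs(3) by simp
    ultimately show ?thesis
      using False gpath_connects[OF g order.refl] by (auto simp: induces_connected_def B_def restr_def)
  qed
  have dj: "disjoint_family_on B {..<7}"
    unfolding disjoint_family_on_def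
  proof (intro ballI impI)
    fix m n :: nat assume mn: "m \<in> {..<7}" "n \<in> {..<7}" "m \<noteq> n"
    have *: "xs ! i \<notin> set (drop 6 xs)" if "i < 6" for i
    proof -
      have "xs ! i \<in> set (take 6 xs)" using that xs(3) by (auto simp: in_set_conv_nth intro!: exI[of _ i])
      then show ?thesis using d set_take_disj_set_drop_if_distinct[OF d, of 6 6] by auto
    qed
    show "B m \<inter> B n = {}"
      using mn * d xs(3) by (auto simp: B_def nth_eq_iff_index_eq)
  qed
  have e: "\<exists>x\<in>B i. \<exists>y\<in>B ((i + 1) mod 7). {x, y} \<in> E" if i7: "i < 7" for i
  proof -
    have E: "{xs ! i, xs ! Suc i} \<in> E" if "Suc i < length xs" for i
      using xs(1) that unfolding gpath_def by (metis successively_nth)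
    have six: "xs ! 6 \<in> set (drop 6 xs)" "last xs \<in> set (drop 6 xs)" "hd xs = xs ! 0"
      using xs(3) hd_drop_conv_nth[of 6 xs] last_drop[of 6 xs] hd_in_set[of "drop 6 xs"]
        last_in_set[of "drop 6 xs"] hd_conv_nth[of xs] by (cases "xs = []"; auto)+
    consider "i < 5" | "i = 5" | "i = 6" using i7 by linarith
    then show ?thesis
    proof cases
      case 1
      then show ?thesis using E[of i] xs(3) by (simp add: B_def)
    next
      case 2
      then show ?thesis using E[of 5] xs(3) six by (auto simp: B_def)
    next
      case 3
      then show ?thesis using xs(2) six by (auto simp: B_def)
    qed
  qed
  have "\<exists>x\<in>B h. \<exists>y\<in>B k. {x, y} \<in> E" if "{h, k} \<in> edges (cycle_graph 7)" for h k
    using cycle_edges_nat7[OF that] e by (metis insert_commute)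
  then have "is_minor (cycle_graph 7) (V, E)"
    unfolding is_minor_def using B dj by (intro exI[of _ B]) (auto simp: cycle_graph_def)
  then show False using assms(2) by blast
qed

section \<open>Bridges, and a linear bound on the number of edges\<close>

lemma gpath_leaves:
  assumes "gpath E xs" "x \<in> set xs" "y \<in> set xs" "x \<in> K" "y \<notin> K"
  shows "\<exists>a b as bs. xs = as @ a # b # bs \<and> (a \<in> K \<longleftrightarrow> b \<notin> K)"
  using assms
proof (induction xs arbitrary: x y)
  case (Cons z zs)
  show ?case
  proof (cases "zs = []")
    case True
    then show ?thesis using Cons.prems by auto
  next
    case False
    then obtain w ws where zs: "zs = w # ws" by (meson list.exhaust)
    show ?thesis
    proof (cases "z \<in> K \<longleftrightarrow> w \<in> K")
      case True
      have "\<exists>x' y'. x' \<in> set zs \<and> y' \<in> set zs \<and> x' \<in> K \<and> y' \<notin> K"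
        using Cons.prems True zs by (metis list.set_intros(1) set_ConsD)
      then obtain a b as bs where "zs = as @ a # b # bs" "a \<in> K \<longleftrightarrow> b \<notin> K"
        using Cons.IH Cons.prems(1) by (auto simp: gpath_Cons) blast+
      then show ?thesis by (metis append_Cons)
    next
      case False
      then show ?thesis using zs by (metis append_Nil)
    qed
  qed
qed simp

lemma gpath_insert_cases:
  assumes "gpath (insert e E) xs"
  shows "gpath E xs \<or> (\<exists>a b as bs. xs = as @ a # b # bs \<and> {a, b} = e)"
  using assms
proof (induction xs)
  case (Cons z zs)
  then consider "gpath E zs" | "\<exists>a b as bs. zs = as @ a # b # bs \<and> {a, b} = e"
    by (auto simp: gpath_Cons)
  then show ?case
  proof cases
    case 1
    show ?thesis
    proof (cases "zs = [] \<or> {z, hd zs} \<in> E")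
      case True
      then show ?thesis using 1 Cons.prems by (auto simp: gpath_Cons)
    next
      case False
      then have "{z, hd zs} = e" "zs \<noteq> []" using Cons.prems by (auto simp: gpath_Cons)
      then have "z # zs = [] @ z # hd zs # tl zs \<and> {z, hd zs} = e" by simp
      then show ?thesis by blast
    qed
  next
    case 2
    then show ?thesis by (metis append_Cons)
  qed
qed simp

text \<open>No edge of \<open>E\<close> leaves \<open>K\<close>, so the new edge is a bridge: a
  cycle through it would contain a path in \<open>E\<close> from \<open>w\<close> to
  \<open>y\<close>, and hence an edge of \<open>E\<close> leaving \<open>K\<close>.\<close>

lemma short_cycles_insert_bridge:
  assumes E: "short_cycles E"
    and K: "\<And>a b. {a, b} \<in> E \<Longrightarrow> a \<in> K \<Longrightarrow> b \<in> K"
    and wy: "w \<in> K" "y \<notin> K"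
  shows "short_cycles (insert {w, y} E)"
  unfolding short_cycles_def
proof (intro allI impI, elim conjE)
  fix xs assume xs: "gpath (insert {w, y} E) xs" and c: "{last xs, hd xs} \<in> insert {w, y} E"
  have no_path: False if q: "gpath E q" "x \<in> set q" "z \<in> set q" "x \<in> K" "z \<notin> K" for q x z
  proof -
    obtain a b as bs where "q = as @ a # b # bs" "a \<in> K \<longleftrightarrow> b \<notin> K" using gpath_leaves[OF q] by blast
    moreover from this q(1) have "{a, b} \<in> E" by (simp add: gpath_append gpath_Cons)
    ultimately show False using K by (metis insert_commute)
  qed
  show "length xs \<le> 6"
  proof (cases "gpath E xs")
    case True
    show ?thesis
    proof (cases "{last xs, hd xs} \<in> E")
      case False
      then have eq: "{last xs, hd xs} = {w, y}" using c by simp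
      show ?thesis
      proof (cases "xs = []")
        case ne: False
        then have "w \<in> set xs" "y \<in> set xs" using eq by (auto simp: doubleton_eq_iff)
        then show ?thesis using no_path[OF True] wy by blast
      qed simp
    qed (use True short_cyclesD[OF E] in auto)
  next
    case False
    then obtain a b as bs where ab: "xs = as @ a # b # bs" "{a, b} = {w, y}"
      using gpath_insert_cases[OF xs] by blast
    have d: "distinct xs" using xs by (rule gpath_distinct)
    show ?thesis
    proof (cases "as = [] \<and> bs = []")
      case True then show ?thesis using ab by simp
    next
      case ne: False
      \<comment> \<open>The cycle is rotated to start at \<open>b\<close> and end at
        \<open>a\<close>, so that the edge between them becomes the closing one.\<close>
      let ?q = "(b # bs) @ (as @ [a])"
      have "gpath (insert {w, y} E) (b # bs)" "gpath (insert {w, y} E) (as @ [a])"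
        using xs ab(1) by (auto simp: gpath_append gpath_Cons)
      moreover have "{last (b # bs), hd (as @ [a])} \<in> insert {w, y} E"
        using c ab(1) by (cases as) auto
      ultimately have "gpath (insert {w, y} E) ?q"
        using d ab(1) by (subst gpath_append) auto
      \<comment> \<open>With at least three vertices, the two ends \<open>b\<close> and
        \<open>a\<close> of the list are not consecutive in it, so the rotated path uses edges of
        \<open>E\<close> only.\<close>
      moreover have "\<not> (\<exists>a' b' as' bs'. ?q = as' @ a' # b' # bs' \<and> {a', b'} = {w, y})"
      proof
        assume "\<exists>a' b' as' bs'. ?q = as' @ a' # b' # bs' \<and> {a', b'} = {w, y}"
        then obtain a' b' as' bs' where *: "?q = as' @ a' # b' # bs'" "{a', b'} = {a, b}"
          using ab(2) by auto
        have dq: "distinct ?q" using d ab(1) by auto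
        have b0: "?q ! 0 = b" by simp
        have bl: "?q ! (length ?q - 1) = a" by (simp add: nth_append)
        have 1: "?q ! length as' = a'" "?q ! Suc (length as') = b'" unfolding *(1) by (simp_all add: nth_append)
        have len: "Suc (length as') < length ?q" unfolding *(1) by simp
        have l3: "length ?q \<ge> 3" using ne by (cases as; cases bs) auto
        have "a' = b \<and> b' = a \<or> a' = a \<and> b' = b" using *(2) by (auto simp: doubleton_eq_iff)
        then show False
        proof
          assume "a' = b \<and> b' = a"
          then have "?q ! length as' = ?q ! 0" "?q ! Suc (length as') = ?q ! (length ?q - 1)"
            using 1 b0 bl by simp_all
          moreover have "0 < length ?q" "length as' < length ?q" "length ?q - 1 < length ?q"
            using len by linarith+
          ultimately have "length as' = 0" "Suc (length as') = length ?q - 1"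
            using len nth_eq_iff_index_eq[OF dq] by blast+
          then show False using l3 by simp
        next
          assume "a' = a \<and> b' = b"
          then have "Suc (length as') = 0"
            using 1(2) b0 len nth_eq_iff_index_eq[OF dq, of "Suc (length as')" 0] by fastforce
          then show False by simp
        qed
      qed
      ultimately have "gpath E ?q" using gpath_insert_cases by blast
      moreover have "w \<in> set ?q" "y \<in> set ?q" using ab(2) by (auto simp: doubleton_eq_iff)
      ultimately show ?thesis using no_path wy by blast
    qed
  qed
qed

text \<open>Degeneracy: an end \<open>x\<close> of a longest path has all its neighbours on that
  path and, by the cycle bound, among the next five vertices. Deleting \<open>x\<close> loses at
  most five edges.\<close>

lemma card_edges_le:
  assumes "finite V" "\<And>e. e \<in> E \<Longrightarrow> e \<subseteq> V \<and> card e = 2" "short_cycles E"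
  shows "finite E \<and> card E \<le> 5 * card V"
  using assms
proof (induction "card V" arbitrary: V E)
  case 0
  then have "V = {}" by simp
  then have "E = {}" using 0(3) by fastforce
  then show ?case by simp
next
  case (Suc k)
  have ne: "V \<noteq> {}" using Suc(2) by auto
  define PP where "PP = {xs. gpath E xs \<and> set xs \<subseteq> V \<and> xs \<noteq> []}"
  have "finite PP"
    by (rule finite_subset[OF _ finite_subset_distinct[OF Suc.prems(1)]]) (auto simp: PP_def gpath_def)
  moreover have "PP \<noteq> {}"
  proof -
    obtain z where "z \<in> V" using ne by blast
    then have "[z] \<in> PP" by (simp add: PP_def gpath_Cons)
    then show ?thesis by blast
  qed
  ultimately obtain p where p: "p \<in> PP" "\<And>q. q \<in> PP \<Longrightarrow> length q \<le> length p"
    using finite_has_maximal[of "length ` PP"] by (metis (no_types, opaque_lifting) Max_ge Max_in finite_imageI image_iff image_is_empty)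
  obtain x r where xr: "p = x # r" using p(1) by (auto simp: PP_def neq_Nil_conv)
  have gp: "gpath E p" "set p \<subseteq> V" using p(1) by (auto simp: PP_def)
  have xV: "x \<in> V" using gp xr by simp
  have nb: "y \<in> set (take 5 r)" if "{x, y} \<in> E" for y
  proof -
    have xy: "x \<noteq> y" "y \<in> V" using Suc.prems(2)[OF that] by auto
    have "y \<in> set p"
    proof (rule ccontr)
      assume "y \<notin> set p"
      then have "y # p \<in> PP" using gp xy that xr by (auto simp: PP_def gpath_Cons insert_commute)
      then show False using p(2) by fastforce
    qed
    then obtain as bs where r: "r = as @ y # bs" using xr xy by (metis set_ConsD split_list)
    have "gpath E (x # as @ [y])" using gp(1) xr r by (auto simp: gpath_Cons gpath_append hd_append)
    moreover have "{last (x # as @ [y]), hd (x # as @ [y])} \<in> E" using that by (simp add: insert_commute)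
    ultimately have "length (x # as @ [y]) \<le> 6" using Suc.prems(3) short_cyclesD by blast
    then have "length as \<le> 4" by simp
    then show ?thesis by (simp add: r take_Cons' )
  qed
  define F where "F = {e \<in> E. x \<notin> e}"
  have "finite F \<and> card F \<le> 5 * card (V - {x})"
  proof (rule Suc.hyps(1))
    show "k = card (V - {x})" using Suc.hyps(2) xV Suc.prems(1) by simp
    show "\<And>e. e \<in> F \<Longrightarrow> e \<subseteq> V - {x} \<and> card e = 2" using Suc.prems(2) by (auto simp: F_def)
    show "short_cycles F" using Suc.prems(3) by (rule short_cycles_mono) (auto simp: F_def)
  qed (use Suc.prems(1) in simp)
  moreover have sub: "E \<subseteq> F \<union> (\<lambda>y. {x, y}) ` set (take 5 r)"
  proof
    fix e assume e: "e \<in> E"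
    show "e \<in> F \<union> (\<lambda>y. {x, y}) ` set (take 5 r)"
    proof (cases "x \<in> e")
      case True
      then obtain y where "e = {x, y}" using Suc.prems(2)[OF e] by (metis card_2_iff insertE insert_commute singletonD)
      then show ?thesis using nb e by auto
    qed (use e in \<open>simp add: F_def\<close>)
  qed
  moreover have "card ((\<lambda>y. {x, y}) ` set (take 5 r)) \<le> 5"
    by (rule order.trans[OF card_image_le]) (auto intro: order.trans[OF card_length])
  ultimately have "finite E" "card E \<le> 5 * card (V - {x}) + 5"
    using card_mono[OF _ sub] card_Un_le[of F "(\<lambda>y. {x, y}) ` set (take 5 r)"]
    by (auto intro: finite_subset)
  then show ?case using xV Suc.prems(1) Suc.hyps(2) by simp
qed

section \<open>The blocks at a vertex\<close>

definition loop_at :: "'a set set \<Rightarrow> 'a \<Rightarrow> 'a list \<Rightarrow> bool" where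
  "loop_at E v p \<longleftrightarrow> gpath E p \<and> p \<noteq> [] \<and> v \<notin> set p \<and> {v, hd p} \<in> E \<and> {v, last p} \<in> E"

text \<open>The vertices other than \<open>v\<close> of the blocks that contain \<open>v\<close>; a loop consisting of a
  single neighbour accounts for the bridges at \<open>v\<close>.\<close>

definition loop_verts :: "'a set set \<Rightarrow> 'a \<Rightarrow> 'a set" where
  "loop_verts E v = \<Union>(set ` {p. loop_at E v p})"

lemma loop_at_subset: "loop_at E v p \<Longrightarrow> set p \<subseteq> loop_verts E v"
  by (auto simp: loop_verts_def)

lemma loop_vertsE:
  assumes "x \<in> loop_verts E v" obtains p where "loop_at E v p" "x \<in> set p"
  using assms by (auto simp: loop_verts_def)

lemma loop_at_rev: "loop_at E v p \<Longrightarrow> loop_at E v (rev p)"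
  by (auto simp: loop_at_def hd_rev last_rev)

lemma not_in_loop_verts: "v \<notin> loop_verts E v"
  by (auto simp: loop_verts_def loop_at_def)

lemma neighbour_in_loop_verts: "{v, x} \<in> E \<Longrightarrow> x \<noteq> v \<Longrightarrow> x \<in> loop_verts E v"
  using loop_at_subset[of E v "[x]"] by (auto simp: loop_at_def gpath_Cons)

lemma loop_at_length: "short_cycles E \<Longrightarrow> loop_at E v p \<Longrightarrow> length p \<le> 5"
  using short_cyclesD[of E "v # p"] by (auto simp: loop_at_def gpath_Cons insert_commute)

text \<open>The ear replaces the stretch of the loop between \<open>x\<close> and \<open>h\<close>,
  and the result is again a loop at \<open>v\<close>.\<close>

lemma ear_between_loop_vertices:
  assumes p: "loop_at E v p" and xh: "x \<in> set p" "h \<in> set p" "x \<noteq> h"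
    and r: "gpath E (x # r @ [h])" "set r \<inter> set p = {}" "v \<notin> set r"
  shows "set r \<subseteq> loop_verts E v"
proof -
  have *: "set r \<subseteq> loop_verts E v"
    if q: "loop_at E v q" "q = a @ x # b" "h \<in> set b" "set r \<inter> set q = {}" for q a b
  proof -
    obtain b1 b2 where b: "b = b1 @ h # b2" using q(3) by (meson split_list)
    have 1: "gpath E a" "a = [] \<or> {last a, x} \<in> E" "gpath E (h # b2)" "v \<notin> set q"
      and 2: "set a \<inter> set (x # b) = {}" "x \<notin> set b"
      using q(1,2) b by (auto simp: loop_at_def gpath_append gpath_Cons)
    have 3: "hd (a @ x # r @ h # b2) = hd q" "last (a @ x # r @ h # b2) = last q"
      using q(2) b by (auto simp: hd_append)
    have "gpath E (x # r)" "{last (x # r), h} \<in> E"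
      using r(1) gpath_append[of E "x # r" "[h]"] by auto
    moreover have "set (x # r) \<inter> set (h # b2) = {}" using q(2,4) b 2 by auto
    ultimately have "gpath E ((x # r) @ (h # b2))" using 1(3) by (subst gpath_append) simp
    moreover have "set a \<inter> set ((x # r) @ (h # b2)) = {}" using q(2,4) b 2 by auto
    ultimately have "gpath E (a @ ((x # r) @ (h # b2)))" using 1(1,2) by (subst gpath_append) auto
    then have "loop_at E v (a @ x # r @ h # b2)"
      using q(1,2) r(3) b 1(4) 3 by (simp add: loop_at_def)
    from loop_at_subset[OF this] show ?thesis by simp
  qed
  obtain a b where ab: "p = a @ x # b" using xh(1) by (meson split_list)
  show ?thesis
  proof (cases "h \<in> set b")
    case True
    then show ?thesis using * p ab r(2) by blast
  next
    case False
    then have "h \<in> set (rev a)" using ab xh by auto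
    then show ?thesis using *[OF loop_at_rev[OF p], of "rev b" "rev a"] ab r(2)
      by (simp add: Un_commute)
  qed
qed

text \<open>Here the ear replaces everything after \<open>x\<close> on the loop, its last vertex
  being adjacent to \<open>v\<close>.\<close>

lemma ear_from_loop_vertex_to_neighbour:
  assumes p: "loop_at E v p" and x: "x \<in> set p"
    and r: "gpath E (x # r)" "r \<noteq> []" "set r \<inter> set p = {}" "v \<notin> set r" "{v, last r} \<in> E"
  shows "set r \<subseteq> loop_verts E v"
proof -
  obtain a b where ab: "p = a @ x # b" using x by (meson split_list)
  have "loop_at E v (a @ x # r)"
    using p ab r by (auto simp: loop_at_def gpath_append gpath_Cons hd_append)
  from loop_at_subset[OF this] show ?thesis by simp
qed

text \<open>From \<open>x'\<close> the ear is continued along a loop through \<open>x'\<close> until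
  it first meets the loop of \<open>x\<close>, or else to the end of its own loop, next to
  \<open>v\<close>. Either way it becomes an ear of the loop of \<open>x\<close>, so its vertices
  are loop vertices.\<close>

lemma no_ear_outside_loop_verts:
  assumes x: "x \<in> loop_verts E v" "x' \<in> loop_verts E v"
    and r: "gpath E (x # r @ [x'])" "r \<noteq> []" "v \<notin> set r" "set r \<inter> loop_verts E v = {}"
  shows False
proof -
  have contra: False if "set r \<subseteq> loop_verts E v" using that r(2,4) by (cases r) auto
  obtain p where p: "loop_at E v p" "x \<in> set p" using x(1) by (rule loop_vertsE)
  obtain q where q: "loop_at E v q" "x' \<in> set q" using x(2) by (rule loop_vertsE)
  have pW: "set p \<subseteq> loop_verts E v" using p(1) by (rule loop_at_subset)
  have rp: "set r \<inter> set p = {}" using r(4) pW by blast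
  have neq: "x \<noteq> x'" using r(1) by (auto simp: gpath_Cons)
  show False
  proof (cases "x' \<in> set p")
    case True
    then show False using ear_between_loop_vertices[OF p True neq r(1) rp r(3)] contra by blast
  next
    case x'p: False
    \<comment> \<open>One of the two directions of \<open>q\<close> from \<open>x'\<close> avoids
      \<open>x\<close>.\<close>
    obtain q' c d where d: "loop_at E v q'" "q' = c @ x' # d" "x \<notin> set d"
    proof -
      obtain c d where cd: "q = c @ x' # d" using q(2) by (meson split_list)
      show ?thesis
      proof (cases "x \<in> set d")
        case False then show ?thesis using that q cd by blast
      next
        case True
        then have "x \<notin> set (rev c)" using cd gpath_distinct[of E q] q(1) by (auto simp: loop_at_def)
        then show ?thesis using that[OF loop_at_rev[OF q(1)], of "rev d" "rev c"] cd by simp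
      qed
    qed
    have dW: "set (x' # d) \<subseteq> loop_verts E v" using loop_at_subset[OF d(1)] d(2) by auto
    have vd: "v \<notin> set (x' # d)" "gpath E (x' # d)" "{v, last (x' # d)} \<in> E"
      using d(1,2) by (auto simp: loop_at_def gpath_append)
    have rd: "set r \<inter> set (x' # d) = {}" using dW r(4) by blast
    have full: "gpath E (x # r @ x' # d)"
      using r(1,2) vd(2) rd neq d(3) by (auto simp: gpath_Cons gpath_append)
    show False
    proof (cases "set d \<inter> set p = {}")
      case True
      have "set (r @ x' # d) \<subseteq> loop_verts E v"
        using full True x'p rp vd r(3)
        by (intro ear_from_loop_vertex_to_neighbour[OF p]) auto
      then show False using contra by simp
    next
      case False
      then have "\<exists>z\<in>set d. z \<in> set p" by blast
      then obtain d1 h d2 where h: "d = d1 @ h # d2" "h \<in> set p" "\<forall>z\<in>set d1. z \<notin> set p"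
        by (rule split_list_first_propE)
      have "set (r @ x' # d1) \<subseteq> loop_verts E v"
      proof (rule ear_between_loop_vertices[OF p h(2)])
        show "x \<noteq> h" using d(3) h(1) by auto
        have eq: "x # r @ x' # d = (x # (r @ x' # d1) @ [h]) @ d2" using h(1) by simp
        show "gpath E (x # (r @ x' # d1) @ [h])"
          using full unfolding eq by (simp only: gpath_append)
        show "set (r @ x' # d1) \<inter> set p = {}" using h(3) rp x'p by auto
        show "v \<notin> set (r @ x' # d1)" using r(3) vd(1) h(1) by auto
      qed
      then show False using contra by simp
    qed
  qed
qed

section \<open>Separation by deleting the block edges, and path lengths inside the blocks\<close>

definition block_edges :: "'a set set \<Rightarrow> 'a \<Rightarrow> 'a set set" where
  "block_edges E v = {e \<in> E. e \<subseteq> insert v (loop_verts E v)}"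

text \<open>A connecting path, cut at its first return to the set, would be an ear. A single edge
  would be a block edge. If a longer ear has an end at \<open>v\<close>, the vertex next to it is a
  neighbour of \<open>v\<close> and hence a loop vertex; all other ears are excluded by
  \<open>no_ear_outside_loop_verts\<close>.\<close>

lemma outside_block_edges_separated:
  assumes x: "x \<in> insert v (loop_verts E v)" "x' \<in> insert v (loop_verts E v)"
    and c: "(x, x') \<in> (restr (E - block_edges E v) UNIV)\<^sup>*"
  shows "x = x'"
proof (rule ccontr)
  assume neq: "x \<noteq> x'"
  let ?U = "insert v (loop_verts E v)" and ?F = "E - block_edges E v"
  obtain p where p: "gpath ?F p" "p \<noteq> []" "hd p = x" "last p = x'"
    using connects_gpath[OF c] by auto
  obtain s where s: "p = x # s" using p by (cases p) auto
  have "s \<noteq> []" using s p(4) neq by auto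
  then have "\<exists>z\<in>set s. z \<in> ?U" using s p(4) x(2) by (auto intro!: bexI[of _ x'] simp del: insert_iff)
  then obtain r t r' where t: "s = r @ t # r'" "t \<in> ?U" "\<forall>z\<in>set r. z \<notin> ?U"
    by (rule split_list_first_propE)
  have g: "gpath ?F (x # r @ [t])"
    using p(1) s t(1) by (auto simp: gpath_Cons gpath_append hd_append)
  have gE: "gpath E (x # r @ [t])" using g by (rule gpath_mono) auto
  show False
  proof (cases "r = []")
    case True
    then have "{x, t} \<in> ?F" using g by (simp add: gpath_Cons)
    then show False using x(1) t(2) by (auto simp: block_edges_def)
  next
    case False
    have vr: "v \<notin> set r" using t(3) by auto
    have "x \<noteq> v"
    proof
      assume "x = v"
      then have "hd r \<in> loop_verts E v"
        using gE False vr by (intro neighbour_in_loop_verts) (auto simp: gpath_Cons)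
      then show False using t(3) False by auto
    qed
    moreover have "t \<noteq> v"
    proof
      assume "t = v"
      then have "last r \<in> loop_verts E v"
        using gE False vr by (intro neighbour_in_loop_verts) (auto simp: gpath_Cons gpath_append insert_commute)
      then show False using t(3) False by auto
    qed
    ultimately show False
      using no_ear_outside_loop_verts[of x E v t r] x(1) t(2,3) gE False by blast
  qed
qed

text \<open>Consecutive visits to \<open>S\<close> are separated by at most four other vertices, so
  each visit accounts for at most five vertices of the path.\<close>

lemma detour_length:
  assumes "distinct xs" "xs \<noteq> []" "hd xs \<in> S" "last xs \<in> S" "finite S"
    and "\<And>a s b t c. xs = a @ s # b @ t # c \<Longrightarrow> s \<in> S \<Longrightarrow> t \<in> S \<Longrightarrow> set b \<inter> S = {} \<Longrightarrow> length b \<le> 4"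
  shows "length xs \<le> 5 * card (S \<inter> set xs)"
  using assms(1-4,6)
proof (induction "length xs" arbitrary: xs rule: less_induct)
  case less
  obtain s r where xs: "xs = s # r" using less.prems(2) by (cases xs) auto
  have sS: "s \<in> S" using xs less.prems by simp
  show ?case
  proof (cases "r = []")
    case True
    then show ?thesis using xs sS by simp
  next
    case False
    then have "\<exists>z\<in>set r. z \<in> S" using xs less.prems(4) by auto
    then obtain b t c where t: "r = b @ t # c" "t \<in> S" "\<forall>z\<in>set b. z \<notin> S"
      by (rule split_list_first_propE)
    have b: "length b \<le> 4" using less.prems(5)[of "[]" s b t c] xs t sS by auto
    have IH: "length (t # c) \<le> 5 * card (S \<inter> set (t # c))"
    proof (rule less.hyps)
      show "length b' \<le> 4" if "t # c = a @ s' # b' @ t' # c'" "s' \<in> S" "t' \<in> S" "set b' \<inter> S = {}"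
        for a s' b' t' c'
        using less.prems(5)[of "s # b @ a" s' b' t' c'] that xs t(1) by simp
    qed (use less.prems xs t in auto)
    have "card (insert s (S \<inter> set (t # c))) \<le> card (S \<inter> set xs)"
      using assms(5) xs t(1) sS by (intro card_mono) auto
    moreover have "s \<notin> S \<inter> set (t # c)" using less.prems(1) xs t(1) by auto
    ultimately have "Suc (card (S \<inter> set (t # c))) \<le> card (S \<inter> set xs)"
      using assms(5) by simp
    then show ?thesis using IH b xs t(1) by simp
  qed
qed

text \<open>Loops through the two ends of the path, together with \<open>v\<close>, form a connected
  set \<open>S\<close> of at most 5 + 5 + 1 vertices. An excursion from \<open>S\<close> is closed
  to a cycle by a path in \<open>S\<close> with at least two vertices, so it has at most four
  vertices itself. This gives 5 * 11.\<close>

lemma path_in_loop_verts_length: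
  assumes E: "short_cycles E" and xs: "gpath E xs" "set xs \<subseteq> loop_verts E v"
  shows "length xs \<le> 55"
proof (cases "xs = []")
  case False
  obtain p where p: "loop_at E v p" "hd xs \<in> set p" using xs False by (meson hd_in_set loop_vertsE subsetD)
  obtain q where q: "loop_at E v q" "last xs \<in> set q" using xs False by (meson last_in_set loop_vertsE subsetD)
  define S where "S = insert v (set p \<union> set q)"
  have cS: "card S \<le> 11"
  proof -
    have "card S \<le> Suc (card (set p \<union> set q))" by (simp add: S_def card_insert_le_m1 card_insert_if)
    also have "\<dots> \<le> Suc (card (set p) + card (set q))" using card_Un_le by simp
    also have "\<dots> \<le> Suc (5 + 5)"
      using loop_at_length[OF E p(1)] loop_at_length[OF E q(1)] card_length[of p] card_length[of q] by linarith
    finally show ?thesis by simp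
  qed
  have tov: "(z, v) \<in> (restr E S)\<^sup>*" if "z \<in> set p'" "loop_at E v p'" "set p' \<subseteq> S" for z p'
  proof -
    have "(z, hd p') \<in> (restr E S)\<^sup>*" using that gpath_connects[of E p' S z "hd p'"] by (auto simp: loop_at_def)
    moreover have "(hd p', v) \<in> restr E S" 
    proof -
      have "hd p' \<in> S" "{hd p', v} \<in> E"
        using that hd_in_set[of p'] by (auto simp: loop_at_def insert_commute simp del: hd_in_set)
      then show ?thesis by (simp add: restr_def S_def)
    qed
    ultimately show ?thesis by simp
  qed
  have "(z, v) \<in> (restr E S)\<^sup>*" if "z \<in> S" for z
    using that tov[OF _ p(1), of z] tov[OF _ q(1), of z] unfolding S_def by auto
  then have conn: "(z, z') \<in> (restr E S)\<^sup>*" if "z \<in> S" "z' \<in> S" for z z'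
    using that by (meson restr_rtrancl_sym rtrancl_trans)
  have "length xs \<le> 5 * card (S \<inter> set xs)"
  proof (rule detour_length)
    fix a s b t c
    assume *: "xs = a @ s # b @ t # c" "s \<in> S" "t \<in> S" "set b \<inter> S = {}"
    show "length b \<le> 4"
    proof (cases "b = []")
      case ne: False
      obtain r where r: "gpath E r" "r \<noteq> []" "set r \<subseteq> S" "hd r = t" "last r = s"
        using connects_gpath[OF conn[OF *(3,2)] *(3)] by blast
      have "s \<noteq> t" using xs(1) *(1) by (auto simp: gpath_append gpath_Cons)
      then have l2: "length r \<ge> 2" using r by (cases r; cases "tl r") auto
      have "gpath E (s # b @ t # c)" using xs(1) *(1) by (simp add: gpath_append)
      then have "gpath E b" "{s, hd b} \<in> E" "{last b, t} \<in> E"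
        using ne by (auto simp: gpath_Cons gpath_append)
      then have "length (b @ r) \<le> 6"
        using r *(4) ne by (intro short_cyclesD[OF E]) (auto simp: gpath_append)
      then show ?thesis using l2 by simp
    qed simp
  qed (use xs(1) False p q in \<open>auto simp: S_def gpath_distinct\<close>)
  also have "card (S \<inter> set xs) \<le> card S" by (rule card_mono) (auto simp: S_def)
  finally show ?thesis using cS by simp
qed simp

section \<open>Elimination trees\<close>

definition comps :: "'a set set \<Rightarrow> 'a set \<Rightarrow> 'a set set" where
  "comps E S = (\<lambda>x. (restr E S)\<^sup>* `` {x}) ` S"

definition conn :: "'a set set \<Rightarrow> 'a set \<Rightarrow> bool" where
  "conn E S \<longleftrightarrow> S \<noteq> {} \<and> (\<forall>x\<in>S. \<forall>y\<in>S. (x, y) \<in> (restr E S)\<^sup>*)"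

lemma compsE:
  assumes "K \<in> comps E S" "x \<in> K"
  shows "x \<in> S" "K = (restr E S)\<^sup>* `` {x}"
proof -
  obtain z where z: "z \<in> S" "K = (restr E S)\<^sup>* `` {z}" using assms(1) by (auto simp: comps_def)
  show "x \<in> S" using restr_rtrancl_in[of z x E S] assms(2) z by auto
  have "(z, x) \<in> (restr E S)\<^sup>*" "(x, z) \<in> (restr E S)\<^sup>*"
    using assms(2) z restr_rtrancl_sym by auto
  then show "K = (restr E S)\<^sup>* `` {x}" using z(2) by (auto intro: rtrancl_trans)
qed

lemma Union_comps: "\<Union>(comps E S) = S"
proof
  show "\<Union>(comps E S) \<subseteq> S" by (rule Union_least, rule subsetI, rule compsE(1))
  show "S \<subseteq> \<Union>(comps E S)" by (auto simp: comps_def)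
qed

lemma comps_subset: "K \<in> comps E S \<Longrightarrow> K \<subseteq> S"
  using Union_comps[of E S] by blast

lemma comps_disjoint: "K \<in> comps E S \<Longrightarrow> L \<in> comps E S \<Longrightarrow> x \<in> K \<Longrightarrow> x \<in> L \<Longrightarrow> K = L"
  using compsE(2) by metis

lemma comps_closed:
  assumes "K \<in> comps E S" "x \<in> K" "y \<in> S" "{x, y} \<in> E" shows "y \<in> K"
proof -
  have "(x, y) \<in> restr E S" using compsE(1)[OF assms(1,2)] assms(3,4) by (simp add: restr_def)
  then show ?thesis using compsE(2)[OF assms(1,2)] by auto
qed

lemma comps_path_subset:
  assumes "K \<in> comps E S" "x \<in> K" "gpath E p" "set p \<subseteq> S" "x \<in> set p"
  shows "set p \<subseteq> K"
  using gpath_connects[OF assms(3,4,5)] compsE(2)[OF assms(1,2)] by auto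

lemma conn_comps:
  assumes "K \<in> comps E S" shows "conn E K"
  unfolding conn_def
proof (intro conjI ballI)
  show "K \<noteq> {}" using assms by (auto simp: comps_def)
  fix x y assume xy: "x \<in> K" "y \<in> K"
  then have "(x, y) \<in> (restr E S)\<^sup>*" using compsE(2)[OF assms xy(1)] by auto
  then obtain p where p: "gpath E p" "p \<noteq> []" "set p \<subseteq> S" "hd p = x" "last p = y"
    using connects_gpath compsE(1)[OF assms xy(1)] by metis
  have "x \<in> set p" using p by auto
  then have "set p \<subseteq> K" using comps_path_subset[OF assms xy(1) p(1,3)] by blast
  then show "(x, y) \<in> (restr E K)\<^sup>*" using gpath_connects[OF p(1)] p by (metis hd_in_set last_in_set)
qed

lemma comps_conn: "conn E S \<Longrightarrow> comps E S = {S}"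
proof -
  assume S: "conn E S"
  have "(restr E S)\<^sup>* `` {x} = S" if "x \<in> S" for x
    using S that restr_rtrancl_in[of x _ E S] by (auto simp: conn_def)
  then show ?thesis using S by (auto simp: comps_def conn_def)
qed

lemma finite_comps: "finite S \<Longrightarrow> finite (comps E S)"
  by (simp add: comps_def)

text \<open>A path that starts in \<open>K\<close> and avoids \<open>A\<close> also avoids
  \<open>a\<close>, so it stays in \<open>K\<close>. Thus a hypothesis on the components of
  \<open>S - A\<close> passes to \<open>K\<close> in an induction.\<close>

lemma comps_comp_diff:
  assumes K: "K \<in> comps E (S - {a})" and a: "a \<in> A"
  shows "comps E (K - A) \<subseteq> comps E (S - A)"
proof
  fix C assume "C \<in> comps E (K - A)"
  then obtain x where x: "x \<in> K - A" "C = (restr E (K - A))\<^sup>* `` {x}" by (auto simp: comps_def)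
  have KS: "K - A \<subseteq> S - A" using comps_subset[OF K] by auto
  have "(x, y) \<in> (restr E (K - A))\<^sup>*" if xy: "(x, y) \<in> (restr E (S - A))\<^sup>*" for y
  proof -
    obtain p where p: "gpath E p" "p \<noteq> []" "set p \<subseteq> S - A" "hd p = x" "last p = y"
      using connects_gpath[OF xy] KS x(1) by blast
    have "set p \<subseteq> K"
      using p x(1) a by (intro comps_path_subset[OF K, of x]) auto
    then have "set p \<subseteq> K - A" using p(3) by blast
    then show ?thesis using gpath_connects[OF p(1)] p by (metis hd_in_set last_in_set)
  qed
  then have "C = (restr E (S - A))\<^sup>* `` {x}"
    using x(2) restr_rtrancl_mono[OF _ order.refl KS] by blast
  then show "C \<in> comps E (S - A)" using x(1) KS by (auto simp: comps_def)
qed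

lemma relpow_mono_rel:
  fixes R S :: "('a \<times> 'a) set"
  shows "R \<subseteq> S \<Longrightarrow> R ^^ n \<subseteq> S ^^ n"
  by (induction n) auto

text \<open>An elimination tree on \<open>S\<close> with root \<open>r\<close>, given by its child-to-parent relation \<open>P\<close>.\<close>

definition elim_tree :: "'a set set \<Rightarrow> 'a set \<Rightarrow> 'a \<Rightarrow> ('a \<times> 'a) set \<Rightarrow> nat \<Rightarrow> bool" where
  "elim_tree E S r P h \<longleftrightarrow> r \<in> S \<and> P \<subseteq> S \<times> S \<and> single_valued P \<and> r \<notin> Domain P \<and>
     (\<forall>s\<in>S. \<exists>j\<le>h. (s, r) \<in> P ^^ j) \<and>
     (\<forall>x\<in>S. \<forall>y\<in>S. {x, y} \<in> E \<longrightarrow> x \<noteq> y \<longrightarrow> (\<exists>j\<le>h. (x, y) \<in> P ^^ j \<or> (y, x) \<in> P ^^ j))"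

text \<open>\<open>g\<close> will be a constant per vertex with a further factor \<open>u\<close> at
  marks. A small weight forces large factorials of the numbers of children. The sum of the products
  of these factorials over all parent maps is known from \<open>sum_PiE_prod_fact\<close>, so only
  few trees have small weight.\<close>

definition tree_weight :: "('a \<Rightarrow> real) \<Rightarrow> ('a \<times> 'a) set \<Rightarrow> 'a set \<Rightarrow> real" where
  "tree_weight g P S = (\<Prod>s\<in>S. g s / fact (card {x. (x, s) \<in> P}))"

definition elim_bounded :: "'a set set \<Rightarrow> ('a \<Rightarrow> real) \<Rightarrow> 'a set \<Rightarrow> nat \<Rightarrow> real \<Rightarrow> bool" where
  "elim_bounded E g S h R \<longleftrightarrow> (\<exists>r P. elim_tree E S r P h \<and> tree_weight g P S \<le> R)"

lemma elim_bounded_mono: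
  assumes "elim_bounded E g S h R" "h \<le> h'" "R \<le> R'" shows "elim_bounded E g S h' R'"
proof -
  obtain r P where "elim_tree E S r P h" "tree_weight g P S \<le> R"
    using assms(1) by (auto simp: elim_bounded_def)
  moreover from this have "elim_tree E S r P h'"
    unfolding elim_tree_def using assms(2) by (meson order.trans)
  ultimately show ?thesis using assms(3) unfolding elim_bounded_def by (meson order.trans)
qed

lemma elim_tree_root:
  assumes S: "finite S" "a \<in> S" and g: "\<And>s. s \<in> S \<Longrightarrow> 0 \<le> g s"
    and K: "\<And>K. K \<in> comps E (S - {a}) \<Longrightarrow> elim_bounded E g K h (R K)"
  shows "\<exists>P. elim_tree E S a P (Suc h) \<and>
    tree_weight g P S \<le> g a * (\<Prod>K\<in>comps E (S - {a}). R K) / fact (card (comps E (S - {a})))"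
proof -
  define KK where "KK = comps E (S - {a})"
  have finKK: "finite KK" using S by (simp add: KK_def finite_comps)
  have "\<forall>K. \<exists>r P. K \<in> KK \<longrightarrow> elim_tree E K r P h \<and> tree_weight g P K \<le> R K"
    using K by (auto simp: elim_bounded_def KK_def)
  then obtain r where "\<forall>K. \<exists>P. K \<in> KK \<longrightarrow> elim_tree E K (r K) P h \<and> tree_weight g P K \<le> R K"
    using choice[of "\<lambda>K r. \<exists>P. K \<in> KK \<longrightarrow> elim_tree E K r P h \<and> tree_weight g P K \<le> R K"] by blast
  then obtain Q where Q: "\<And>K. K \<in> KK \<Longrightarrow> elim_tree E K (r K) (Q K) h"
    and wQ: "\<And>K. K \<in> KK \<Longrightarrow> tree_weight g (Q K) K \<le> R K"
    using choice[of "\<lambda>K P. K \<in> KK \<longrightarrow> elim_tree E K (r K) P h \<and> tree_weight g P K \<le> R K"] by blast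
  have KU: "\<Union>KK = S - {a}" unfolding KK_def by (rule Union_comps)
  have KD: "K = L" if "K \<in> KK" "L \<in> KK" "x \<in> K" "x \<in> L" for K L x
    using that comps_disjoint unfolding KK_def by metis
  have rK: "r K \<in> K" "Q K \<subseteq> K \<times> K" "single_valued (Q K)" "r K \<notin> Domain (Q K)" if "K \<in> KK" for K
    using Q[OF that] by (auto simp: elim_tree_def)
  define P where "P = (\<Union>K\<in>KK. Q K) \<union> (\<lambda>K. (r K, a)) ` KK"
  have QP: "Q K \<subseteq> P" if "K \<in> KK" for K using that by (auto simp: P_def)
  have rP: "(r K, a) \<in> P" if "K \<in> KK" for K using that by (auto simp: P_def)
  have Pcases: "(y = a \<and> x = r K) \<or> (x, y) \<in> Q K" if "(x, y) \<in> P" "x \<in> K" "K \<in> KK" for x y K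
    using that rK(1,2) KD by (fastforce simp: P_def)
  have PD: "\<exists>K\<in>KK. x \<in> K" if "(x, y) \<in> P" for x y
    using that rK(1,2) by (fastforce simp: P_def)
  have pw: "(x, y) \<in> P ^^ j" if "(x, y) \<in> Q K ^^ j" "K \<in> KK" for x y j K
    using relpow_mono_rel[OF QP[OF that(2)]] that(1) by blast
  have tree: "elim_tree E S a P (Suc h)"
    unfolding elim_tree_def
  proof (intro conjI ballI impI)
    show "a \<in> S" by fact
    show "P \<subseteq> S \<times> S"
    proof -
      have "K \<subseteq> S" if "K \<in> KK" for K using that KU by blast
      then have "Q K \<subseteq> S \<times> S" "r K \<in> S" if "K \<in> KK" for K using rK(1,2)[OF that] that by blast+
      then show ?thesis using S(2) unfolding P_def by blast
    qed
    show "a \<notin> Domain P" using PD KU by blast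
    show "single_valued P"
    proof (rule single_valuedI)
      fix x y z assume xy: "(x, y) \<in> P" "(x, z) \<in> P"
      obtain L where L: "L \<in> KK" "x \<in> L" using PD xy(1) by blast
      show "y = z"
        using Pcases[OF xy(1) L(2,1)] Pcases[OF xy(2) L(2,1)] rK(3,4)[OF L(1)]
        by (auto dest: single_valuedD)
    qed
    show "\<exists>j\<le>Suc h. (s, a) \<in> P ^^ j" if s: "s \<in> S" for s
    proof (cases "s = a")
      case True
      then show ?thesis by (intro exI[of _ 0]) auto
    next
      case False
      then obtain L where L: "L \<in> KK" "s \<in> L" using s KU by blast
      then obtain j where "j \<le> h" "(s, r L) \<in> Q L ^^ j" using Q[OF L(1)] unfolding elim_tree_def by blast
      then show ?thesis using pw[OF _ L(1)] rP[OF L(1)] by (intro exI[of _ "Suc j"]) auto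
    qed
    then have toa: "\<exists>j\<le>Suc h. (s, a) \<in> P ^^ j" if "s \<in> S" for s using that by blast
    show "\<exists>j\<le>Suc h. (x, y) \<in> P ^^ j \<or> (y, x) \<in> P ^^ j"
      if xy: "x \<in> S" "y \<in> S" "{x, y} \<in> E" "x \<noteq> y" for x y
    proof (cases "x = a \<or> y = a")
      case True
      then show ?thesis using toa xy(1,2) by blast
    next
      case False
      then obtain L where L: "L \<in> KK" "x \<in> L" using xy KU by blast
      have "y \<in> L" using comps_closed[of L E "S - {a}" x y] L xy False by (auto simp: KK_def)
      then obtain j where "j \<le> h" "(x, y) \<in> Q L ^^ j \<or> (y, x) \<in> Q L ^^ j"
        using Q[OF L(1)] L(2) xy(3,4) unfolding elim_tree_def by blast
      then show ?thesis using pw[OF _ L(1)] by (intro exI[of _ j]) auto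
    qed
  qed
  have ca: "card {x. (x, a) \<in> P} = card KK"
  proof -
    have "{x. (x, a) \<in> P} = r ` KK"
    proof -
      have "(x, a) \<notin> Q K" if "K \<in> KK" for K x using rK(2)[OF that] KU that by blast
      then show ?thesis by (auto simp: P_def)
    qed
    moreover have "inj_on r KK" using rK(1) KD by (intro inj_onI) metis
    ultimately show ?thesis by (simp add: card_image)
  qed
  have cK: "{x. (x, s) \<in> P} = {x. (x, s) \<in> Q K}" if "K \<in> KK" "s \<in> K" for s K
  proof -
    have "s \<noteq> a" using that KU by blast
    moreover have "L = K" if "L \<in> KK" "(x, s) \<in> Q L" for L x
      using rK(2)[OF that(1)] that KD \<open>K \<in> KK\<close> \<open>s \<in> K\<close> by blast
    ultimately show ?thesis using that by (auto simp: P_def)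
  qed
  have finK: "finite K" if "K \<in> KK" for K 
    using that KU S(1) by (intro finite_subset[of K S]) auto
  have "tree_weight g P S = g a / fact (card KK) * (\<Prod>s\<in>S - {a}. g s / fact (card {x. (x, s) \<in> P}))"
    unfolding tree_weight_def using S by (simp add: prod.remove[of S a] ca)
  also have "(\<Prod>s\<in>S - {a}. g s / fact (card {x. (x, s) \<in> P})) =
      (\<Prod>K\<in>KK. \<Prod>s\<in>K. g s / fact (card {x. (x, s) \<in> P}))"
    unfolding KU[symmetric] using finK KD by (subst prod.Union_disjoint) auto
  also have "\<dots> = (\<Prod>K\<in>KK. tree_weight g (Q K) K)"
    unfolding tree_weight_def by (intro prod.cong refl) (simp add: cK)
  also have "g a / fact (card KK) * \<dots> \<le> g a / fact (card KK) * (\<Prod>K\<in>KK. R K)"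
  proof (intro mult_left_mono prod_mono conjI)
    fix K assume K: "K \<in> KK"
    show "tree_weight g (Q K) K \<le> R K" by (rule wQ[OF K])
    have "K \<subseteq> S" using K KU by blast
    then show "0 \<le> tree_weight g (Q K) K" unfolding tree_weight_def using g by (intro prod_nonneg) auto
  qed (use g S in auto)
  finally show ?thesis using tree unfolding KK_def by auto
qed

lemma power_div_fact_le_exp:
  fixes x :: real assumes "0 \<le> x" shows "x ^ n / fact n \<le> exp x"
proof -
  have "(\<Sum>k\<in>{n}. x ^ k /\<^sub>R fact k) \<le> (\<Sum>k. x ^ k /\<^sub>R fact k)"
    using assms by (intro sum_le_suminf summable_exp_generic) auto
  then show ?thesis by (simp add: exp_def divide_inverse mult.commute)
qed

text \<open>With a common bound \<open>R\<close>, the factorial absorbs the power of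
  \<open>R\<close> whatever the number of components is: a root costs one exponential.\<close>

lemma elim_bounded_root:
  assumes S: "finite S" "a \<in> S" and g: "\<And>s. s \<in> S \<Longrightarrow> 0 \<le> g s" and R: "0 \<le> R"
    and K: "\<And>K. K \<in> comps E (S - {a}) \<Longrightarrow> elim_bounded E g K h R"
  shows "\<exists>P. elim_tree E S a P (Suc h) \<and> tree_weight g P S \<le> g a * exp R"
proof -
  let ?n = "card (comps E (S - {a}))"
  obtain P where "elim_tree E S a P (Suc h)" "tree_weight g P S \<le> g a * R ^ ?n / fact ?n"
    using elim_tree_root[OF S g K] by auto
  moreover have "g a * (R ^ ?n / fact ?n) \<le> g a * exp R"
    using g S R by (intro mult_left_mono power_div_fact_le_exp) auto
  ultimately show ?thesis by fastforce
qed

text \<open>The recursion mirrors the removal of one of \<open>k + 1\<close> separator vertices: one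
  \<open>exp R\<close> bounds the weight of the vertex, another pays for the components free of the
  separator, and at most \<open>k\<close> components still meet the separator.\<close>

fun sep_const :: "nat \<Rightarrow> nat" where
  "sep_const 0 = 1"
| "sep_const (Suc k) = 2 + k * sep_const k"

text \<open>The separator is eliminated vertex by vertex. Below each such vertex all but boundedly
  many components avoid \<open>A\<close> and keep the bound \<open>R\<close>, and only for these is
  the factorial used. So the whole separator costs a single exponential and not a tower of height
  \<open>k\<close>.\<close>

lemma elim_bounded_separator:
  fixes R :: real
  assumes g: "\<And>s. s \<in> S \<Longrightarrow> 0 \<le> g s \<and> g s \<le> R" and R: "1 \<le> R"
    and S: "finite S" "conn E S" and A: "card (A \<inter> S) \<le> k"
    and K: "\<And>K. K \<in> comps E (S - A) \<Longrightarrow> elim_bounded E g K h R"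
  shows "elim_bounded E g S (h + k) (exp (sep_const k * R))"
  using assms(1,3-6)
proof (induction k arbitrary: S)
  case 0
  then have "A \<inter> S = {}" by simp
  then have "S - A = S" by blast
  then have "elim_bounded E g S h R" using 0(5) comps_conn[OF 0(3)] by simp
  moreover have "R \<le> exp R" using exp_ge_add_one_self[of R] by linarith
  ultimately show ?case using elim_bounded_mono[of E g S h R h "exp R"] by simp
next
  case (Suc k)
  have ge1: "1 \<le> sep_const i" for i by (cases i) auto
  let ?B = "exp (sep_const k * R)"
  have B1: "1 \<le> ?B" using R by simp
  have RB: "R \<le> exp (sep_const i * R)" for i
  proof -
    have "R \<le> 1 * R + 1" by simp
    also have "\<dots> \<le> sep_const i * R + 1" using ge1[of i] R by (intro add_mono mult_right_mono) auto
    also have "\<dots> \<le> exp (sep_const i * R)" using exp_ge_add_one_self[of "sep_const i * R"] by linarith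
    finally show ?thesis .
  qed
  show ?case
  proof (cases "A \<inter> S = {}")
    case True
    then have "S - A = S" by blast
    then have "elim_bounded E g S h R" using Suc.prems(5) comps_conn[OF Suc.prems(3)] by simp
    then show ?thesis by (rule elim_bounded_mono[OF _ _ RB]) simp
  next
    case False
    then obtain a where a: "a \<in> A" "a \<in> S" by blast
    define KK where "KK = comps E (S - {a})"
    define KA where "KA = {K \<in> KK. K \<inter> A \<noteq> {}}"
    have finKK: "finite KK" using Suc.prems(2) by (simp add: KK_def finite_comps)
    have KS: "K \<subseteq> S - {a}" if "K \<in> KK" for K using that comps_subset by (auto simp: KK_def)
    have cardA: "card (A \<inter> S - {a}) \<le> k" using Suc.prems(2,4) a by simp
    have KA1: "elim_bounded E g K (h + k) ?B" if "K \<in> KK" for K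
    proof (rule Suc.IH)
      show "finite K" using KS[OF that] Suc.prems(2) finite_subset by blast
      show "conn E K" using that by (auto simp: KK_def intro: conn_comps)
      show "card (A \<inter> K) \<le> k"
      proof (rule order.trans[OF card_mono cardA])
        show "A \<inter> K \<subseteq> A \<inter> S - {a}" using KS[OF that] by blast
      qed (use Suc.prems(2) in simp)
      show "elim_bounded E g C h R" if "C \<in> comps E (K - A)" for C
        using comps_comp_diff[of K E S a A] that \<open>K \<in> KK\<close> a(1) Suc.prems(5) unfolding KK_def by blast
    qed (use Suc.prems(1) KS[OF that] in auto)
    have KA2: "elim_bounded E g K (h + k) R" if "K \<in> KK" "K \<notin> KA" for K
    proof -
      have "K - A = K" using that by (auto simp: KA_def)
      then have "K \<in> comps E (S - A)"
        using comps_comp_diff[of K E S a A] that a comps_conn[OF conn_comps[of K E "S - {a}"]] by (auto simp: KK_def)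
      from elim_bounded_mono[OF Suc.prems(5)[OF this] le_add1 order.refl] show ?thesis .
    qed
    have cKA: "card KA \<le> k"
    proof -
      have "\<forall>K\<in>KA. \<exists>b. b \<in> K \<inter> A" by (auto simp: KA_def)
      then obtain b where b: "\<And>K. K \<in> KA \<Longrightarrow> b K \<in> K \<inter> A" by metis
      have "inj_on b KA"
      proof (rule inj_onI)
        fix K L assume KL: "K \<in> KA" "L \<in> KA" "b K = b L"
        then have "b K \<in> K" "b K \<in> L" using b[OF KL(1)] b[OF KL(2)] by auto
        then show "K = L" using comps_disjoint[of K E "S - {a}" L "b K"] KL by (auto simp: KA_def KK_def)
      qed
      moreover have "b ` KA \<subseteq> A \<inter> S - {a}" 
      proof
        fix z assume "z \<in> b ` KA"
        then obtain K where K: "K \<in> KA" "z = b K" by blast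
        then show "z \<in> A \<inter> S - {a}" using b[OF K(1)] KS[of K] by (auto simp: KA_def)
      qed
      ultimately have "card KA \<le> card (A \<inter> S - {a})"
        using Suc.prems(2) by (intro card_inj_on_le) auto
      then show ?thesis using cardA by simp
    qed
    define RK where "RK K = (if K \<in> KA then ?B else R)" for K
    have RK: "elim_bounded E g K (h + k) (RK K)" if "K \<in> comps E (S - {a})" for K
      using KA1 KA2 that by (simp add: RK_def KK_def)
    obtain P where P: "elim_tree E S a P (Suc (h + k))"
      "tree_weight g P S \<le> g a * (\<Prod>K\<in>KK. RK K) / fact (card KK)"
      using elim_tree_root[OF Suc.prems(2) a(2) _ RK] Suc.prems(1) unfolding KK_def by blast
    let ?m = "card (KK - KA)"
    have KAK: "KA \<subseteq> KK" by (auto simp: KA_def)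
    have "(\<Prod>K\<in>KK. RK K) = (\<Prod>K\<in>KK - KA. RK K) * (\<Prod>K\<in>KA. RK K)"
      using finKK KAK by (rule prod.subset_diff[rotated])
    also have "\<dots> = R ^ ?m * ?B ^ card KA" by (simp add: RK_def)
    finally have pr: "(\<Prod>K\<in>KK. RK K) = R ^ ?m * ?B ^ card KA" .
    have fm: "fact ?m \<le> (fact (card KK) :: real)"
      using finKK by (intro fact_mono card_mono) auto
    have "tree_weight g P S \<le> g a * (R ^ ?m * ?B ^ card KA) / fact (card KK)"
      using P(2) pr by simp
    \<comment> \<open>The factorial is spent on the components free of \<open>A\<close>; the others
      number at most \<open>k\<close>.\<close>
    also have "\<dots> \<le> g a * (R ^ ?m * ?B ^ card KA) / fact ?m"
      using fm Suc.prems(1)[OF a(2)] R by (intro divide_left_mono mult_nonneg_nonneg) auto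
    also have "\<dots> = g a * (R ^ ?m / fact ?m) * ?B ^ card KA" by simp
    also have "\<dots> \<le> R * exp R * ?B ^ k"
      using Suc.prems(1)[OF a(2)] R B1 cKA power_div_fact_le_exp[of R ?m]
      by (intro mult_mono power_increasing mult_nonneg_nonneg zero_le_power) auto
    also have "\<dots> \<le> exp R * exp R * ?B ^ k"
    proof -
      have "R \<le> exp R" using exp_ge_add_one_self[of R] by linarith
      then show ?thesis by (intro mult_right_mono) simp_all
    qed
    also have "?B ^ k = exp (k * (sep_const k * R))" by (simp add: exp_of_nat_mult)
    also have "exp R * exp R * \<dots> = exp (sep_const (Suc k) * R)"
      by (simp add: exp_add[symmetric] algebra_simps)
    finally have "tree_weight g P S \<le> exp (sep_const (Suc k) * R)" .
    then show ?thesis using P(1) by (auto simp: elim_bounded_def)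
  qed
qed

section \<open>Marked paths\<close>

text \<open>Marked paths have both ends in \<open>X\<close> and are measured by vertices. A single
  mark is one, so the bound 0 excludes marks and the bound 1 leaves a connected set at most one
  mark. With \<open>X = UNIV\<close> every path is marked.\<close>

definition mpaths_le :: "'a set set \<Rightarrow> 'a set \<Rightarrow> 'a set \<Rightarrow> nat \<Rightarrow> bool" where
  "mpaths_le E S X l \<longleftrightarrow>
     (\<forall>p. gpath E p \<and> p \<noteq> [] \<and> set p \<subseteq> S \<and> hd p \<in> X \<and> last p \<in> X \<longrightarrow> length p \<le> l)"

lemma mpaths_le_mono: "mpaths_le E S X l \<Longrightarrow> T \<subseteq> S \<Longrightarrow> l \<le> m \<Longrightarrow> mpaths_le E T X m"
  unfolding mpaths_le_def by (meson order.trans)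

lemma longer_half:
  assumes "gpath E p" "z \<in> set p" "hd p \<in> X" "last p \<in> X"
  obtains q where "gpath E q" "q \<noteq> []" "hd q = z" "last q \<in> X" "set q \<subseteq> set p"
    "length p + 1 \<le> 2 * length q"
proof -
  obtain a b where ab: "p = a @ z # b" using assms(2) by (meson split_list)
  have g1: "gpath E (z # b)" using assms(1) ab by (simp add: gpath_append)
  have "gpath E ((a @ [z]) @ b)" using assms(1) ab by simp
  then have "gpath E (a @ [z])" by (simp only: gpath_append)
  then have g2: "gpath E (z # rev a)" using gpath_rev[of E "a @ [z]"] by simp
  have l: "last (z # b) \<in> X" "last (z # rev a) \<in> X"
    using assms(3,4) ab by (cases a; auto simp: last_rev)+
  show ?thesis
  proof (cases "length a \<le> length b")
    case True
    then show ?thesis using that[of "z # b"] g1 l ab by auto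
  next
    case False
    then show ?thesis using that[of "z # rev a"] g2 l ab by auto
  qed
qed

text \<open>A marked path in \<open>S - set p\<close>, joined to the longest marked path \<open>p\<close> through \<open>S\<close>, yields
  a marked path made of the longer half of each; so it has at least two vertices fewer than \<open>p\<close>.\<close>

lemma marked_path_avoiding_longest:
  assumes S: "conn E S"
    and p: "gpath E p" "p \<noteq> []" "set p \<subseteq> S" "hd p \<in> X" "last p \<in> X"
    and maxp: "mpaths_le E S X (length p)"
    and q: "gpath E q" "q \<noteq> []" "set q \<subseteq> S - set p" "hd q \<in> X" "last q \<in> X"
  shows "length q + 2 \<le> length p"
proof -
  have inS: "hd q \<in> S" "hd p \<in> S" using p q hd_in_set[of q] hd_in_set[of p] by blast+
  then obtain t where t: "gpath E t" "t \<noteq> []" "set t \<subseteq> S" "hd t = hd q" "last t = hd p"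
    using connects_gpath[of "hd q" "hd p" E S] S by (auto simp: conn_def)
  \<comment> \<open>\<open>z\<close> is the first vertex of the connecting path on \<open>p\<close>,
    and \<open>y\<close> the last one on \<open>q\<close> before it, so \<open>w\<close> avoids both
    paths.\<close>
  have "\<exists>z\<in>set t. z \<in> set p" using t p by (metis last_in_set hd_in_set)
  then obtain t1 z t2 where z: "t = t1 @ z # t2" "z \<in> set p" "\<forall>y\<in>set t1. y \<notin> set p"
    by (rule split_list_first_propE)
  have t1: "t1 \<noteq> []"
  proof
    assume "t1 = []"
    then have "hd q \<in> set p" using z t(4) by simp
    then show False using q hd_in_set[of q] by blast
  qed
  have "hd t1 = hd q" using t(4) t1 z(1) by simp
  then have "\<exists>y\<in>set t1. y \<in> set q" using t1 q(2) by (metis hd_in_set)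
  then obtain u y w where y: "t1 = u @ y # w" "y \<in> set q" "\<forall>x\<in>set w. x \<notin> set q"
    by (rule split_list_last_propE)
  have "gpath E (u @ (y # w @ [z]) @ t2)" using t(1) z(1) y(1) by simp
  then have yz: "gpath E (y # w @ [z])" by (simp only: gpath_append)
  obtain p' where p': "gpath E p'" "p' \<noteq> []" "hd p' = z" "last p' \<in> X" "set p' \<subseteq> set p"
    "length p + 1 \<le> 2 * length p'"
    using longer_half[OF p(1) z(2) p(4,5)] by blast
  obtain q' where q': "gpath E q'" "q' \<noteq> []" "hd q' = y" "last q' \<in> X" "set q' \<subseteq> set q"
    "length q + 1 \<le> 2 * length q'"
    using longer_half[OF q(1) y(2) q(4,5)] by blast
  have wp: "set w \<inter> set p = {}" "set w \<inter> set q = {}" "set q \<inter> set p = {}" "set w \<subseteq> S"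
    using z y q t by auto
  have r1: "gpath E (w @ p')"
    using yz p' wp(1) by (auto simp: gpath_append gpath_Cons)
  have "{last (rev q'), hd (w @ p')} \<in> E"
    using yz p' q' by (cases w) (auto simp: gpath_Cons last_rev)
  then have r: "gpath E (rev q' @ w @ p')"
    using r1 q' p' wp by (subst gpath_append) auto
  moreover have "set (rev q' @ w @ p') \<subseteq> S" using q' p' wp q(3) p(3) by auto
  moreover have "hd (rev q' @ w @ p') \<in> X" "last (rev q' @ w @ p') \<in> X"
    using q' p' by (auto simp: hd_append hd_rev)
  ultimately have "length (rev q' @ w @ p') \<le> length p"
    using maxp q'(2) unfolding mpaths_le_def by blast
  then show ?thesis using p'(6) q'(6) by simp
qed

lemma longest_marked_path:
  assumes "finite S" and ne: "S \<inter> X \<noteq> {}"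
  obtains p where "gpath E p" "p \<noteq> []" "set p \<subseteq> S" "hd p \<in> X" "last p \<in> X" "mpaths_le E S X (length p)"
proof -
  define PP where "PP = {p. gpath E p \<and> p \<noteq> [] \<and> set p \<subseteq> S \<and> hd p \<in> X \<and> last p \<in> X}"
  have fin: "finite PP"
    by (rule finite_subset[OF _ finite_subset_distinct[OF assms(1)]]) (auto simp: PP_def gpath_def)
  obtain x where "x \<in> S" "x \<in> X" using ne by blast
  then have "[x] \<in> PP" by (simp add: PP_def gpath_Cons)
  then have "length ` PP \<noteq> {}" by blast
  then have "Max (length ` PP) \<in> length ` PP" using fin by (intro Max_in) auto
  then obtain p where p: "p \<in> PP" "length p = Max (length ` PP)" by auto
  have "length q \<le> length p" if "q \<in> PP" for q using p(2) fin that by simp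
  then show ?thesis using that[of p] p(1) by (simp add: PP_def mpaths_le_def)
qed

text \<open>The separator is a longest marked path. By \<open>marked_path_avoiding_longest\<close>
  marked paths in the remaining components are shorter by two, so one exponential lowers
  \<open>l\<close> by two.\<close>

lemma elim_bounded_marked_step:
  fixes R :: real
  assumes g: "\<And>s. s \<in> U \<Longrightarrow> 0 \<le> g s \<and> g s \<le> R" and R: "1 \<le> R" and U: "finite U"
    and base: "\<And>S. S \<subseteq> U \<Longrightarrow> conn E S \<Longrightarrow> mpaths_le E S X (l - 2) \<Longrightarrow> elim_bounded E g S h R"
    and S: "S \<subseteq> U" "conn E S" "mpaths_le E S X l"
  shows "elim_bounded E g S (h + l) (exp (sep_const l * R))"
proof -
  have finS: "finite S" using S(1) U finite_subset by blast
  have gS: "0 \<le> g s \<and> g s \<le> R" if "s \<in> S" for s using g S(1) that by blast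
  show ?thesis
  proof (cases "S \<inter> X = {}")
    case True
    \<comment> \<open>Without marks there are no marked paths, and the empty separator
      serves.\<close>
    have "mpaths_le E S X (l - 2)"
      unfolding mpaths_le_def using True by (metis disjoint_iff hd_in_set subsetD)
    then have "elim_bounded E g S h R" using base S by blast
    then show ?thesis
      using comps_conn[OF S(2)] by (intro elim_bounded_separator[OF gS R finS S(2), where A = "{}"]) auto
  next
    case False
    obtain p where p: "gpath E p" "p \<noteq> []" "set p \<subseteq> S" "hd p \<in> X" "last p \<in> X" "mpaths_le E S X (length p)"
      using longest_marked_path[OF finS False] by metis
    have lp: "length p \<le> l" using S(3) p unfolding mpaths_le_def by blast
    show ?thesis
    proof (rule elim_bounded_separator[OF gS R finS S(2), where A = "set p"])
      show "card (set p \<inter> S) \<le> l"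
        using lp p(3) card_length[of p] by (metis Int_absorb2 order.trans)
      fix K assume K: "K \<in> comps E (S - set p)"
      have KS: "K \<subseteq> S - set p" using K by (rule comps_subset)
      show "elim_bounded E g K h R"
      proof (rule base)
        show "K \<subseteq> U" using KS S(1) by blast
        show "conn E K" using K by (rule conn_comps)
        show "mpaths_le E K X (l - 2)"
          unfolding mpaths_le_def
        proof (intro allI impI, elim conjE)
          fix q assume q: "gpath E q" "q \<noteq> []" "set q \<subseteq> K" "hd q \<in> X" "last q \<in> X"
          have "set q \<subseteq> S - set p" using q(3) KS by blast
          from marked_path_avoiding_longest[OF S(2) p q(1,2) this q(4,5)] lp
          show "length q \<le> l - 2" by linarith
        qed
      qed
    qed
  qed
qed

section \<open>Elimination trees for unmarked sets and for all blocks at a vertex\<close>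

text \<open>Bound for sets whose paths have at most \<open>2 * j\<close> vertices: every vertex is
  treated as a mark and \<open>elim_bounded_marked_step\<close> is iterated. The result is a tower
  of exponentials, but in \<open>c\<close> alone and not in \<open>u\<close>.\<close>

fun unmarked_bound :: "real \<Rightarrow> nat \<Rightarrow> real" where
  "unmarked_bound c 0 = c"
| "unmarked_bound c (Suc j) = exp (sep_const (2 * j + 2) * unmarked_bound c j)"

fun unmarked_height :: "nat \<Rightarrow> nat" where
  "unmarked_height 0 = 0"
| "unmarked_height (Suc j) = unmarked_height j + (2 * j + 2)"

lemma sep_const_ge_1: "1 \<le> sep_const k"
  by (cases k) auto

lemma unmarked_bound_ge: "1 \<le> c \<Longrightarrow> c \<le> unmarked_bound c j"
proof (induction j)
  case (Suc j)
  let ?b = "unmarked_bound c j"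
  have b: "1 \<le> ?b" using Suc by linarith
  have "?b \<le> 1 * ?b + 1" by simp
  also have "\<dots> \<le> sep_const (2 * j + 2) * ?b + 1"
    using sep_const_ge_1[of "2 * j + 2"] b by (intro add_mono mult_right_mono) auto
  also have "\<dots> \<le> exp (sep_const (2 * j + 2) * ?b)"
    using exp_ge_add_one_self[of "sep_const (2 * j + 2) * ?b"] by linarith
  finally have "?b \<le> unmarked_bound c (Suc j)" by simp
  then show ?case using Suc by linarith
qed simp

lemma elim_bounded_short_paths:
  assumes c: "1 \<le> c" and U: "finite U" and g: "\<And>s. s \<in> U \<Longrightarrow> 0 \<le> g s \<and> g s \<le> c"
    and S: "S \<subseteq> U" "conn E S" "mpaths_le E S UNIV (2 * j)"
  shows "elim_bounded E g S (unmarked_height j) (unmarked_bound c j)"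
  using S
proof (induction j arbitrary: S)
  case 0
  \<comment> \<open>For \<open>j = 0\<close> a single vertex is already too long a path, so no
    connected set qualifies.\<close>
  then obtain x where "x \<in> S" by (auto simp: conn_def)
  then have "gpath E [x] \<and> [x] \<noteq> [] \<and> set [x] \<subseteq> S \<and> hd [x] \<in> UNIV \<and> last [x] \<in> UNIV"
    by (simp add: gpath_Cons)
  then have "length [x] \<le> 2 * 0" using 0(3) unfolding mpaths_le_def by blast
  then show ?case by simp
next
  case (Suc j)
  have gb: "0 \<le> g s \<and> g s \<le> unmarked_bound c j" if "s \<in> U" for s
    using g[OF that] unmarked_bound_ge[OF c, of j] by linarith
  have "elim_bounded E g S (unmarked_height j + (2 * j + 2)) (exp (sep_const (2 * j + 2) * unmarked_bound c j))"
  proof (rule elim_bounded_marked_step[OF gb _ U _ Suc.prems(1,2)])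
    show "1 \<le> unmarked_bound c j" using unmarked_bound_ge[OF c, of j] c by linarith
    show "mpaths_le E S UNIV (2 * j + 2)" using Suc.prems(3) by simp
    show "elim_bounded E g S (unmarked_height j) (unmarked_bound c j)"
      if "S \<subseteq> U" "conn E S" "mpaths_le E S UNIV (2 * j + 2 - 2)" for S
      using Suc.IH that by simp
  qed
  then show ?case by simp
qed

text \<open>The summand 10 is 1 for \<open>v\<close>, 5 and 3 for the marked paths removed in turn,
  and 1 for the last mark. 28 is half of 56, the length bound used for paths among the loop
  vertices.\<close>

definition star_height :: nat where "star_height = 10 + unmarked_height 28"

text \<open>From the inside outwards: the bound after the last mark, after a marked path of at most
  3 vertices, after one of at most 5, and after the root \<open>v\<close>. In \<open>u\<close> it is
  a triple exponential.\<close>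

definition star_bound :: "real \<Rightarrow> real \<Rightarrow> real" where
  "star_bound c u = c * exp (exp (sep_const 5 * exp (sep_const 3 * (c * u * exp (unmarked_bound c 28)))))"

text \<open>After the removal of marked paths of lengths at most 5 and 3, a connected set has at
  most one mark. That mark becomes a root above unmarked sets, whose bound is independent of
  \<open>u\<close>; so \<open>u\<close> enters linearly there and then passes through three
  exponentials.\<close>

lemma elim_tree_star:
  fixes c u :: real
  assumes c: "1 \<le> c" and u: "1 \<le> u" and W: "finite W" "v \<notin> W" and v: "{v} \<notin> T"
    and m: "mpaths_le T W {x. {v, x} \<in> T} 5" and short: "mpaths_le T W UNIV 56"
  defines "g \<equiv> \<lambda>s. if {v, s} \<in> T then c * u else c"
  shows "\<exists>P. elim_tree T (insert v W) v P star_height \<and> tree_weight g P (insert v W) \<le> star_bound c u"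
proof -
  let ?X = "{x. {v, x} \<in> T}"
  define K0 where "K0 = unmarked_bound c 28"
  define h0 where "h0 = unmarked_height 28"
  define R1 where "R1 = c * u * exp K0"
  define R3 where "R3 = exp (sep_const 3 * R1)"
  define R5 where "R5 = exp (sep_const 5 * R3)"
  have K0: "c \<le> K0" unfolding K0_def by (rule unmarked_bound_ge[OF c])
  have cu: "c \<le> c * u" using c u mult_left_mono[of 1 u c] by simp
  then have cu1: "1 \<le> c * u" using c by linarith
  note cu = cu cu1
  have g0: "0 \<le> g s \<and> g s \<le> c * u" for s using c u cu by (auto simp: g_def)
  have e1: "1 \<le> exp K0" using K0 c by simp
  have R1: "c * u \<le> R1" "K0 \<le> R1" "1 \<le> R1"
  proof -
    have "c * u * 1 \<le> c * u * exp K0" using e1 cu by (intro mult_left_mono) auto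
    then show 1: "c * u \<le> R1" by (simp add: R1_def)
    have "1 * exp K0 \<le> c * u * exp K0" using cu by (intro mult_right_mono) auto
    then show "K0 \<le> R1" using exp_ge_add_one_self[of K0] unfolding R1_def by linarith
    show "1 \<le> R1" using 1 cu by linarith
  qed
  have expR: "x \<le> exp (sep_const k * x)" if "1 \<le> x" for x :: real and k
  proof -
    have "x \<le> 1 * x + 1" by simp
    also have "\<dots> \<le> sep_const k * x + 1"
      using sep_const_ge_1[of k] that by (intro add_mono mult_right_mono) auto
    also have "\<dots> \<le> exp (sep_const k * x)"
      using exp_ge_add_one_self[of "sep_const k * x"] by linarith
    finally show ?thesis .
  qed
  have R3: "R1 \<le> R3" unfolding R3_def using R1 by (intro expR) auto
  have R5: "R3 \<le> R5" unfolding R5_def using R1 R3 by (intro expR) auto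
  have unm: "elim_bounded T g S h0 K0" if S: "S \<subseteq> W" "conn T S" "S \<inter> ?X = {}" for S
    unfolding h0_def K0_def
  proof (rule elim_bounded_short_paths[OF c, where U = S])
    show "finite S" using S W finite_subset by blast
    show "0 \<le> g s \<and> g s \<le> c" if "s \<in> S" for s using S(3) that c by (auto simp: g_def)
    show "mpaths_le T S UNIV (2 * 28)" using mpaths_le_mono[OF short S(1)] by simp
  qed (use S in auto)
  have L1: "elim_bounded T g S (Suc h0) R1"
    if S: "S \<subseteq> W" "conn T S" "mpaths_le T S ?X 1" for S
  proof (cases "S \<inter> ?X = {}")
    case True
    show ?thesis by (rule elim_bounded_mono[OF unm[OF S(1,2) True] _ R1(2)]) simp
  next
    case False
    then obtain x where x: "x \<in> S" "{v, x} \<in> T" by blast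
    have finS: "finite S" using S W finite_subset by blast
    \<comment> \<open>Two marks in a connected set would be joined by a marked path with at least
      two vertices.\<close>
    have uniq: "y = x" if y: "y \<in> S" "{v, y} \<in> T" for y
    proof (rule ccontr)
      assume "y \<noteq> x"
      obtain p where p: "gpath T p" "p \<noteq> []" "set p \<subseteq> S" "hd p = x" "last p = y"
        using connects_gpath[of x y T S] S(2) x y by (auto simp: conn_def)
      then have "length p \<le> 1" using S(3) x y unfolding mpaths_le_def by auto
      then show False using p \<open>y \<noteq> x\<close> by (cases p) auto
    qed
    have "\<exists>P. elim_tree T S x P (Suc h0) \<and> tree_weight g P S \<le> g x * exp K0"
    proof (rule elim_bounded_root[OF finS x(1)])
      show "0 \<le> K0" using K0 c by linarith
      fix K assume K: "K \<in> comps T (S - {x})"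
      show "elim_bounded T g K h0 K0"
      proof (rule unm)
        show "K \<subseteq> W" using comps_subset[OF K] S(1) by blast
        show "conn T K" using K by (rule conn_comps)
        show "K \<inter> ?X = {}" using comps_subset[OF K] uniq by blast
      qed
    qed (use g0 in auto)
    moreover have "g x * exp K0 = R1" using x by (simp add: g_def R1_def)
    ultimately show ?thesis by (auto simp: elim_bounded_def)
  qed
  have L3: "elim_bounded T g S (Suc h0 + 3) R3"
    if S: "S \<subseteq> W" "conn T S" "mpaths_le T S ?X 3" for S
    unfolding R3_def
  proof (rule elim_bounded_marked_step[OF _ R1(3) W(1) _ S])
    show "0 \<le> g s \<and> g s \<le> R1" for s using g0[of s] R1 by linarith
  qed (use L1 in auto)
  have L5: "elim_bounded T g S (Suc h0 + 3 + 5) R5"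
    if S: "S \<subseteq> W" "conn T S" "mpaths_le T S ?X 5" for S
    unfolding R5_def
  proof (rule elim_bounded_marked_step[OF _ _ W(1) _ S])
    show "0 \<le> g s \<and> g s \<le> R3" for s using g0[of s] R1 R3 by linarith
    show "1 \<le> R3" using R1 R3 by linarith
  qed (use L3 in auto)
  have "\<exists>P. elim_tree T (insert v W) v P (Suc (Suc h0 + 3 + 5)) \<and>
      tree_weight g P (insert v W) \<le> g v * exp R5"
  proof (rule elim_bounded_root)
    show "0 \<le> R5" using R1 R3 R5 by linarith
    fix K assume K: "K \<in> comps T (insert v W - {v})"
    then have K': "K \<in> comps T W" using W(2) by simp
    show "elim_bounded T g K (Suc h0 + 3 + 5) R5"
    proof (rule L5)
      show "K \<subseteq> W" using comps_subset[OF K'] .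
      then show "mpaths_le T K ?X 5" by (rule mpaths_le_mono[OF m]) simp
      show "conn T K" using K by (rule conn_comps)
    qed
  qed (use W g0 in auto)
  moreover have "g v = c" using v by (simp add: g_def)
  ultimately show ?thesis
    by (simp add: star_height_def h0_def star_bound_def R5_def R3_def R1_def K0_def)
qed

section \<open>Counting the graphs formed by the blocks at a vertex\<close>

text \<open>The sum counts maps \<open>f\<close> together with a linear order on every fibre.
  Elements are inserted one by one: a fibre with \<open>k\<close> elements offers
  \<open>k + 1\<close> places, so after \<open>i\<close> insertions there are
  \<open>card U + i\<close> places in all.\<close>

lemma sum_PiE_prod_fact:
  assumes "finite W" "finite U"
  shows "(\<Sum>f\<in>W \<rightarrow>\<^sub>E U. \<Prod>s\<in>U. fact (card {x \<in> W. f x = s})) = (\<Prod>i<card W. real (card U + i))"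
  using assms(1)
proof (induction W)
  case empty
  then show ?case by simp
next
  case (insert w W)
  let ?F = "\<lambda>W f. \<Prod>s\<in>U. fact (card {x \<in> W. f x = s}) :: real"
  have upd: "?F (insert w W) (f(w := a)) = real (card {x \<in> W. f x = a} + 1) * ?F W f"
    if "a \<in> U" for f :: "'a \<Rightarrow> 'b" and a
  proof -
    have 1: "{x \<in> insert w W. (f(w := a)) x = s} = {x \<in> W. f x = s}" if "s \<noteq> a" for s
      using that insert.hyps by auto
    have 2: "{x \<in> insert w W. (f(w := a)) x = a} = insert w {x \<in> W. f x = a}"
      using insert.hyps by auto
    have "?F (insert w W) (f(w := a)) =
        fact (card {x \<in> insert w W. (f(w := a)) x = a}) * (\<Prod>s\<in>U - {a}. fact (card {x \<in> W. f x = s}))"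
    proof (subst prod.remove[of U a])
      have "(\<Prod>s\<in>U - {a}. fact (card {x \<in> insert w W. (f(w := a)) x = s}) :: real) =
          (\<Prod>s\<in>U - {a}. fact (card {x \<in> W. f x = s}))"
        by (rule prod.cong[OF refl]) (subst 1, auto)
      then show "fact (card {x \<in> insert w W. (f(w := a)) x = a}) *
          (\<Prod>s\<in>U - {a}. fact (card {x \<in> insert w W. (f(w := a)) x = s})) =
          (fact (card {x \<in> insert w W. (f(w := a)) x = a}) *
          (\<Prod>s\<in>U - {a}. fact (card {x \<in> W. f x = s})) :: real)" by (simp only:)
    qed (use assms(2) that in auto)
    also have "fact (card {x \<in> insert w W. (f(w := a)) x = a}) =
        real (card {x \<in> W. f x = a} + 1) * fact (card {x \<in> W. f x = a})"
      unfolding 2 using insert.hyps by simp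
    finally show ?thesis using assms(2) that by (simp add: prod.remove[of U a] mult.assoc)
  qed
  have tot: "(\<Sum>a\<in>U. real (card {x \<in> W. f x = a} + 1)) = real (card U + card W)"
    if "f \<in> W \<rightarrow>\<^sub>E U" for f
  proof -
    have "(\<Sum>a\<in>U. card {x \<in> W. f x = a}) = card W"
      using sum.group[OF insert.hyps(1) assms(2), of f "\<lambda>_. 1::nat"] that by auto
    then show ?thesis by (simp add: sum.distrib flip: of_nat_sum)
  qed
  have "(\<Sum>f\<in>insert w W \<rightarrow>\<^sub>E U. ?F (insert w W) f) =
      (\<Sum>(a, f)\<in>U \<times> (W \<rightarrow>\<^sub>E U). ?F (insert w W) (f(w := a)))"
    unfolding PiE_insert_eq
    by (subst sum.reindex[OF inj_combinator[OF insert.hyps(2)]]) (simp add: case_prod_unfold)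
  also have "\<dots> = (\<Sum>(a, f)\<in>U \<times> (W \<rightarrow>\<^sub>E U). real (card {x \<in> W. f x = a} + 1) * ?F W f)"
  proof (rule sum.cong[OF refl])
    fix z assume "z \<in> U \<times> (W \<rightarrow>\<^sub>E U)"
    then obtain a f where z: "z = (a, f)" "a \<in> U" by blast
    show "(case z of (a, f) \<Rightarrow> ?F (insert w W) (f(w := a))) =
        (case z of (a, f) \<Rightarrow> real (card {x \<in> W. f x = a} + 1) * ?F W f)"
      unfolding z(1) prod.case by (rule upd[OF z(2)])
  qed
  also have "\<dots> = (\<Sum>f\<in>W \<rightarrow>\<^sub>E U. (\<Sum>a\<in>U. real (card {x \<in> W. f x = a} + 1)) * ?F W f)"
    by (subst sum.cartesian_product[symmetric], subst sum.swap) (simp add: sum_distrib_right)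
  also have "\<dots> = (\<Sum>f\<in>W \<rightarrow>\<^sub>E U. real (card U + card W) * ?F W f)"
    by (intro sum.cong refl) (simp only: tot)
  also have "\<dots> = real (card U + card W) * (\<Prod>i<card W. real (card U + i))"
    by (simp add: insert.IH flip: sum_distrib_left)
  finally show ?case using insert.hyps by (simp add: mult.commute)
qed

text \<open>The product is \<open>fact (2 * n) / fact n\<close>, a central binomial coefficient
  times \<open>fact n\<close>.\<close>

lemma prod_rising_le: "(\<Prod>i<n. real (n + 1 + i)) \<le> 4 ^ n * fact n"
proof -
  have "(\<Prod>i<n. real (n + 1 + i)) * fact n = fact (2 * n)"
  proof -
    have "(\<Prod>i<k. real (n + 1 + i)) * fact n = fact (n + k)" for k
    proof (induction k)
      case (Suc k)
      have "(\<Prod>i<Suc k. real (n + 1 + i)) * fact n =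
          real (n + 1 + k) * ((\<Prod>i<k. real (n + 1 + i)) * fact n)"
        by (simp only: prod.lessThan_Suc mult_ac)
      then show ?case unfolding Suc by simp
    qed simp
    from this[of n] show ?thesis by (simp add: mult_2)
  qed
  also have "fact (2 * n) = real ((2 * n) choose n) * fact n * fact n"
  proof -
    have "fact n * fact n * ((2 * n) choose n) = (fact (2 * n) :: nat)"
      using binomial_fact_lemma[of n "2 * n"] by (simp add: mult_2)
    then have "real (fact n * fact n * ((2 * n) choose n)) = real (fact (2 * n))" by (rule arg_cong)
    then show ?thesis by (simp add: mult_ac)
  qed
  finally have "(\<Prod>i<n. real (n + 1 + i)) = real ((2 * n) choose n) * fact n" by simp
  also have "\<dots> \<le> 4 ^ n * fact n"
  proof -
    have "real ((2 * n) choose n) \<le> real (2 ^ (2 * n))"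
      by (intro of_nat_mono binomial_le_pow2)
    also have "\<dots> = 4 ^ n" by (simp add: power_mult)
    finally have "real ((2 * n) choose n) \<le> 4 ^ n" .
    then show ?thesis by (intro mult_right_mono) auto
  qed
  finally show ?thesis .
qed

section \<open>Codes for block graphs\<close>

definition star_graphs :: "'a \<Rightarrow> 'a set \<Rightarrow> nat \<Rightarrow> 'a set set set" where
  "star_graphs v W D = {T. (\<forall>e\<in>T. e \<subseteq> insert v W \<and> card e = 2) \<and> D \<le> card {x. {v, x} \<in> T} \<and>
     mpaths_le T W {x. {v, x} \<in> T} 5 \<and> mpaths_le T W UNIV 56}"

text \<open>\<open>f\<close> sends a vertex to its parent in the elimination tree, and
  \<open>b\<close> lists the distances to those ancestors to which it is adjacent. Every edge joins
  a vertex to an ancestor at bounded distance, so \<open>f\<close> and \<open>b\<close> determine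
  \<open>T\<close>. The inequality is the weight bound with the factorials moved to the other
  side.\<close>

lemma star_graph_code:
  fixes c u :: real
  assumes c: "1 \<le> c" and u: "1 \<le> u" and W: "finite W" "v \<notin> W" and T: "T \<in> star_graphs v W D"
  shows "\<exists>f b. f \<in> W \<rightarrow>\<^sub>E insert v W \<and> b \<in> W \<rightarrow>\<^sub>E Pow {..star_height} \<and>
    T = {{w, (f ^^ j) w} | w j. w \<in> W \<and> j \<in> b w} \<and>
    c ^ card W * u ^ D \<le> star_bound c u * (\<Prod>s\<in>insert v W. fact (card {x \<in> W. f x = s}))"
proof -
  let ?U = "insert v W"
  have T2: "e \<subseteq> ?U" "card e = 2" if "e \<in> T" for e using T that by (auto simp: star_graphs_def)
  have v1: "{v} \<notin> T" using T2(2) by fastforce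
  define g where "g = (\<lambda>s. if {v, s} \<in> T then c * u else c)"
  obtain P where P: "elim_tree T ?U v P star_height" "tree_weight g P ?U \<le> star_bound c u"
    using elim_tree_star[OF c u W v1] T unfolding g_def star_graphs_def by blast
  note P1 = P(1)[unfolded elim_tree_def]
  note Pp = P1[THEN conjunct2, THEN conjunct1] P1[THEN conjunct2, THEN conjunct2, THEN conjunct1]
    P1[THEN conjunct2, THEN conjunct2, THEN conjunct2, THEN conjunct1]
  note P2 = P1[THEN conjunct2, THEN conjunct2, THEN conjunct2, THEN conjunct2]
  note toroot = P2[THEN conjunct1] and anc = P2[THEN conjunct2]
  have PW: "x \<in> W" if "(x, y) \<in> P" for x y using that Pp(1,3) by blast
  have dom: "\<exists>y. (x, y) \<in> P" if "(x, z) \<in> P ^^ j" "x \<noteq> z" for x z j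
    using that by (metis relpow_0_E relpow_E2 not0_implies_Suc)
  define f where "f = restrict (\<lambda>x. THE y. (x, y) \<in> P) W"
  have fP: "f x = y" if "(x, y) \<in> P" for x y
    using PW[OF that] Pp(2) that unfolding f_def by (auto dest: single_valuedD)
  have Pf: "(x, f x) \<in> P" if xW: "x \<in> W" for x
  proof -
    obtain j where "(x, v) \<in> P ^^ j" using bspec[OF toroot, of x] xW by auto
    moreover have "x \<noteq> v" using xW W(2) by blast
    ultimately obtain y where "(x, y) \<in> P" using dom by blast
    then show ?thesis using fP by auto
  qed
  have fpow: "(f ^^ j) x = y" if "(x, y) \<in> P ^^ j" for x y j
    using that by (induction j arbitrary: y) (auto simp: fP)
  \<comment> \<open>Iterates of \<open>f\<close> beyond the root are harmless: an index is recorded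
    only if the pair is an edge of \<open>T\<close>.\<close>
  define b where "b = restrict (\<lambda>w. {j \<in> {..star_height}. {w, (f ^^ j) w} \<in> T}) W"
  have f1: "f \<in> W \<rightarrow>\<^sub>E ?U"
  proof (rule PiE_I)
    show "f x \<in> ?U" if "x \<in> W" for x using Pf[OF that] Pp(1) by blast
  qed (simp add: f_def)
  have b1: "b \<in> W \<rightarrow>\<^sub>E Pow {..star_height}" by (auto simp: b_def)
  have T1: "T = {{w, (f ^^ j) w} | w j. w \<in> W \<and> j \<in> b w}"
  proof
    show "{{w, (f ^^ j) w} | w j. w \<in> W \<and> j \<in> b w} \<subseteq> T" by (auto simp: b_def)
    show "T \<subseteq> {{w, (f ^^ j) w} | w j. w \<in> W \<and> j \<in> b w}"
    proof
      fix e assume e: "e \<in> T"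
      obtain x y where xy: "e = {x, y}" "x \<noteq> y" using T2(2)[OF e] by (meson card_2_iff)
      have key: "\<exists>w j. {x', y'} = {w, (f ^^ j) w} \<and> w \<in> W \<and> j \<in> b w"
        if a: "{x', y'} \<in> T" "x' \<noteq> y'" "j \<le> star_height" "(x', y') \<in> P ^^ j" for x' y' j
      proof -
        have "x' \<in> W" using dom[OF a(4,2)] PW by blast
        then show ?thesis using a fpow[OF a(4)] by (intro exI[of _ x'] exI[of _ j]) (auto simp: b_def)
      qed
      obtain j where "j \<le> star_height" "(x, y) \<in> P ^^ j \<or> (y, x) \<in> P ^^ j"
        using anc[rule_format, of x y] T2(1)[OF e] e xy by auto
      then have "\<exists>w j. {x, y} = {w, (f ^^ j) w} \<and> w \<in> W \<and> j \<in> b w"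
        using key[of x y j] key[of y x j] e xy by (auto simp: insert_commute)
      then show "e \<in> {{w, (f ^^ j) w} | w j. w \<in> W \<and> j \<in> b w}" using xy by blast
    qed
  qed
  have cs: "{x. (x, s) \<in> P} = {x \<in> W. f x = s}" for s using PW fP Pf by blast
  let ?F = "\<Prod>s\<in>?U. fact (card {x \<in> W. f x = s}) :: real"
  have "(\<Prod>s\<in>?U. g s) / ?F \<le> star_bound c u"
    using P(2) by (simp add: tree_weight_def cs prod_dividef)
  moreover have F0: "0 < ?F" by (intro prod_pos) auto
  ultimately have *: "(\<Prod>s\<in>?U. g s) \<le> star_bound c u * ?F" by (simp add: pos_divide_le_eq)
  have N: "{x. {v, x} \<in> T} = {x \<in> W. {v, x} \<in> T}"
  proof -
    have "x \<in> W" if "{v, x} \<in> T" for x using T2(1)[OF that] v1 that by (cases "x = v") auto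
    then show ?thesis by blast
  qed
  have "(\<Prod>s\<in>W. g s) = (\<Prod>s\<in>W. c * (if {v, s} \<in> T then u else 1))"
    by (intro prod.cong refl) (simp add: g_def)
  also have "\<dots> = c ^ card W * u ^ card {x. {v, x} \<in> T}"
    using W(1) unfolding N by (simp add: prod.distrib prod.If_cases Int_def)
  finally have gW: "(\<Prod>s\<in>W. g s) = c ^ card W * u ^ card {x. {v, x} \<in> T}" .
  have "c ^ card W * u ^ D \<le> c ^ card W * u ^ card {x. {v, x} \<in> T}"
    using c u T by (intro mult_left_mono power_increasing) (auto simp: star_graphs_def)
  also have "\<dots> \<le> g v * (\<Prod>s\<in>W. g s)"
  proof -
    have "1 \<le> g v" using c v1 by (simp add: g_def)
    moreover have "0 \<le> (\<Prod>s\<in>W. g s)" unfolding gW using c u by simp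
    ultimately show ?thesis unfolding gW[symmetric] using mult_right_mono[of 1 "g v"] by fastforce
  qed
  also have "\<dots> = (\<Prod>s\<in>?U. g s)" using W by simp
  finally have "c ^ card W * u ^ D \<le> star_bound c u * ?F" using * by linarith
  with f1 b1 T1 show ?thesis by blast
qed

text \<open>The inequality of \<open>star_graph_code\<close> is summed over all \<open>T\<close>.
  Codes determine graphs, so the right side is at most the sum over all pairs of \<open>f\<close>
  and \<open>b\<close>: the parent maps contribute \<open>4 ^ card W * fact (card W)\<close>, and
  \<open>b\<close> has \<open>2 ^ (star_height + 1)\<close> values at each vertex.\<close>

lemma card_star_graphs:
  fixes c u :: real
  assumes c: "1 \<le> c" and u: "1 \<le> u" and W: "finite W" "v \<notin> W"
  shows "card (star_graphs v W D) * (c ^ card W * u ^ D) \<le>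
    star_bound c u * (2 ^ (star_height + 1) * 4) ^ card W * fact (card W)"
proof -
  let ?U = "insert v W" and ?N = "card W"
  let ?B = "W \<rightarrow>\<^sub>E Pow {..star_height}"
  let ?F = "\<lambda>f. \<Prod>s\<in>?U. fact (card {x \<in> W. f x = s}) :: real"
  define TT where "TT = star_graphs v W D"
  have "\<forall>T. \<exists>q. T \<in> TT \<longrightarrow> fst q \<in> W \<rightarrow>\<^sub>E ?U \<and> snd q \<in> ?B \<and>
    T = {{w, (fst q ^^ j) w} | w j. w \<in> W \<and> j \<in> snd q w} \<and> c ^ ?N * u ^ D \<le> star_bound c u * ?F (fst q)"
  proof
    fix T
    show "\<exists>q. T \<in> TT \<longrightarrow> fst q \<in> W \<rightarrow>\<^sub>E ?U \<and> snd q \<in> ?B \<and>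
      T = {{w, (fst q ^^ j) w} | w j. w \<in> W \<and> j \<in> snd q w} \<and> c ^ ?N * u ^ D \<le> star_bound c u * ?F (fst q)"
    proof (cases "T \<in> TT")
      case True
      obtain f b where "f \<in> W \<rightarrow>\<^sub>E ?U \<and> b \<in> ?B \<and>
        T = {{w, (f ^^ j) w} | w j. w \<in> W \<and> j \<in> b w} \<and> c ^ ?N * u ^ D \<le> star_bound c u * ?F f"
        using star_graph_code[OF c u W True[unfolded TT_def]] by (elim exE) (rule that)
      then show ?thesis by (intro exI[of _ "(f, b)"]) (simp only: fst_conv snd_conv simp_thms)
    qed simp
  qed
  from choice[OF this] obtain q where q: "\<forall>T. T \<in> TT \<longrightarrow> fst (q T) \<in> W \<rightarrow>\<^sub>E ?U \<and> snd (q T) \<in> ?B \<and>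
    T = {{w, (fst (q T) ^^ j) w} | w j. w \<in> W \<and> j \<in> snd (q T) w} \<and>
    c ^ ?N * u ^ D \<le> star_bound c u * ?F (fst (q T))" ..
  define f where "f T = fst (q T)" for T
  define b where "b T = snd (q T)" for T
  note q' = q[rule_format, folded f_def b_def]
  note fb = q'[THEN conjunct1] q'[THEN conjunct2, THEN conjunct1]
    q'[THEN conjunct2, THEN conjunct2, THEN conjunct1] q'[THEN conjunct2, THEN conjunct2, THEN conjunct2]
  have sb: "0 \<le> star_bound c u" using c by (simp add: star_bound_def)
  have inj: "inj_on (\<lambda>T. (f T, b T)) TT"
  proof (rule inj_onI)
    fix S T assume ST: "S \<in> TT" "T \<in> TT" "(f S, b S) = (f T, b T)"
    then have "f S = f T" "b S = b T" by auto
    then show "S = T" using fb(3)[OF ST(1)] fb(3)[OF ST(2)] by simp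
  qed
  have "card TT * (c ^ ?N * u ^ D) = (\<Sum>T\<in>TT. c ^ ?N * u ^ D)" by simp
  also have "\<dots> \<le> (\<Sum>T\<in>TT. star_bound c u * ?F (f T))" by (intro sum_mono fb(4))
  also have "\<dots> = (\<Sum>(f, b)\<in>(\<lambda>T. (f T, b T)) ` TT. star_bound c u * ?F f)"
    by (subst sum.reindex[OF inj]) simp
  also have "\<dots> \<le> (\<Sum>(f, b)\<in>(W \<rightarrow>\<^sub>E ?U) \<times> ?B. star_bound c u * ?F f)"
  proof (rule sum_mono2)
    show "finite ((W \<rightarrow>\<^sub>E ?U) \<times> ?B)" using W(1) by (simp add: finite_PiE)
    show "(\<lambda>T. (f T, b T)) ` TT \<subseteq> (W \<rightarrow>\<^sub>E ?U) \<times> ?B" using fb(1,2) by blast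
    show "0 \<le> (case z of (f, b) \<Rightarrow> star_bound c u * ?F f)" for z :: "('a \<Rightarrow> 'a) \<times> ('a \<Rightarrow> nat set)"
      using sb by (cases z) (simp add: prod_nonneg)
  qed
  also have "\<dots> = (\<Sum>f\<in>W \<rightarrow>\<^sub>E ?U. card ?B * (star_bound c u * ?F f))"
    by (simp flip: sum.cartesian_product)
  also have "\<dots> = card ?B * star_bound c u * (\<Sum>f\<in>W \<rightarrow>\<^sub>E ?U. ?F f)"
    by (simp add: sum_distrib_left mult.assoc)
  also have "(\<Sum>f\<in>W \<rightarrow>\<^sub>E ?U. ?F f) = (\<Prod>i<?N. real (?N + 1 + i))"
    using sum_PiE_prod_fact[OF W(1), of ?U] W by simp
  also have "card ?B * star_bound c u * (\<Prod>i<?N. real (?N + 1 + i)) \<le>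
      card ?B * star_bound c u * (4 ^ ?N * fact ?N)"
    using sb by (intro mult_left_mono prod_rising_le) auto
  also have "card ?B = (2 ^ (star_height + 1)) ^ ?N"
    using W by (simp add: card_PiE card_Pow)
  finally show ?thesis
    by (simp only: TT_def power_mult_distrib of_nat_power of_nat_numeral mult_ac)
qed

section \<open>Switching\<close>

text \<open>The sets \<open>K w\<close> stand for the components of the \<open>w\<close> in
  \<open>F\<close>. An element \<open>w0\<close> with the smallest set is attached anywhere outside
  \<open>K w0\<close>, and the other elements are attached outside \<open>K w0\<close> as well, so
  that its edge is a bridge. The factor \<open>card V'\<close> lost in the induction hypothesis is
  regained as the number of choices for \<open>w0\<close>.\<close>

lemma many_attachments:
  assumes V: "finite V" "v \<in> V" and W: "finite W"
    and K: "\<And>w. w \<in> W \<Longrightarrow> w \<in> K w \<and> K w \<subseteq> V \<and> v \<notin> K w" "disjoint_family_on K W"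
    and F: "\<And>w a b. w \<in> W \<Longrightarrow> {a, b} \<in> F \<Longrightarrow> a \<in> K w \<Longrightarrow> b \<in> K w" "short_cycles F"
  shows "\<exists>Y \<subseteq> W \<rightarrow>\<^sub>E V. (\<forall>y\<in>Y. short_cycles (F \<union> (\<lambda>w. {w, y w}) ` W) \<and> (\<forall>w\<in>W. y w \<notin> K w)) \<and>
    real (card V) ^ card W * fact (card W) \<le> card Y * real (card W) ^ card W * card V"
  using V W K F(1)
proof (induction "card W" arbitrary: V W)
  case 0
  then have "W = {}" by simp
  moreover have "card V \<ge> 1" using 0(2,3) by (metis One_nat_def Suc_leI card_gt_0_iff empty_iff)
  ultimately show ?case using F(2) by (intro exI[of _ "{\<lambda>x. undefined}"]) auto
next
  case (Suc m)
  have Wne: "W \<noteq> {}" using Suc(2) by auto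
  define k where "k = Min ((\<lambda>w. card (K w)) ` W)"
  have "k \<in> (\<lambda>w. card (K w)) ` W" unfolding k_def using Suc.prems(3) Wne by (intro Min_in) auto
  then obtain w0 where w0: "w0 \<in> W" "card (K w0) = k" by auto
  have kmin: "k \<le> card (K w)" if "w \<in> W" for w
    unfolding k_def using Suc.prems(3) that by (intro Min_le) auto
  define V' where "V' = V - K w0"
  define W' where "W' = W - {w0}"
  have finK: "finite (K w)" if "w \<in> W" for w using Suc.prems(1,4) that finite_subset by blast
  have kn: "Suc m * k \<le> card V"
  proof -
    have "Suc m * k = (\<Sum>w\<in>W. k)" using Suc(2) by simp
    also have "\<dots> \<le> (\<Sum>w\<in>W. card (K w))" by (intro sum_mono kmin)
    also have "\<dots> = card (\<Union>w\<in>W. K w)"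
      using Suc.prems(3,5) finK by (subst card_UN_disjoint) (auto simp: disjoint_family_on_def)
    also have "\<dots> \<le> card V" using Suc.prems(1,4) by (intro card_mono) auto
    finally show ?thesis .
  qed
  have cV': "card V' = card V - k"
    unfolding V'_def using w0 finK Suc.prems(4) by (subst card_Diff_subset) auto
  have dj: "K w \<inter> K w0 = {}" if "w \<in> W'" for w
    using Suc.prems(5) that w0(1) by (auto simp: W'_def disjoint_family_on_def)
  have "\<exists>Y \<subseteq> W' \<rightarrow>\<^sub>E V'. (\<forall>y\<in>Y. short_cycles (F \<union> (\<lambda>w. {w, y w}) ` W') \<and> (\<forall>w\<in>W'. y w \<notin> K w)) \<and>
    real (card V') ^ card W' * fact (card W') \<le> card Y * real (card W') ^ card W' * card V'"
  proof (rule Suc.hyps(1))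
    show "m = card W'" using Suc.hyps(2) w0 Suc.prems(3) by (simp add: W'_def)
    show "finite V'" "finite W'" using Suc.prems by (simp_all add: V'_def W'_def)
    show "v \<in> V'" using Suc.prems(2,4) w0(1) by (auto simp: V'_def)
    show "w \<in> K w \<and> K w \<subseteq> V' \<and> v \<notin> K w" if "w \<in> W'" for w
      using Suc.prems(4)[of w] that dj[OF that] by (auto simp: V'_def W'_def)
    show "disjoint_family_on K W'"
      using Suc.prems(5) by (rule disjoint_family_on_mono[rotated]) (auto simp: W'_def)
    show "b \<in> K w" if "w \<in> W'" "{a, b} \<in> F" "a \<in> K w" for w a b
      using Suc.prems(6)[of w a b] that by (auto simp: W'_def)
  qed
  then obtain Y' where Y': "Y' \<subseteq> W' \<rightarrow>\<^sub>E V'"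
    "\<And>y. y \<in> Y' \<Longrightarrow> short_cycles (F \<union> (\<lambda>w. {w, y w}) ` W')"
    "\<And>y w. y \<in> Y' \<Longrightarrow> w \<in> W' \<Longrightarrow> y w \<notin> K w"
    "real (card V') ^ card W' * fact (card W') \<le> card Y' * real (card W') ^ card W' * card V'"
    by blast
  have WW: "W = insert w0 W'" "w0 \<notin> W'" using w0 by (auto simp: W'_def)
  define Y where "Y = (\<lambda>(a, y). y(w0 := a)) ` (V' \<times> Y')"
  have cY: "card Y = card V' * card Y'"
  proof -
    have "inj_on (\<lambda>(a, y). y(w0 := a)) (V' \<times> (W' \<rightarrow>\<^sub>E V'))"
      by (rule inj_combinator[OF WW(2)])
    then have "inj_on (\<lambda>(a, y). y(w0 := a)) (V' \<times> Y')"
      by (rule inj_on_subset) (use Y'(1) in blast)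
    then show ?thesis unfolding Y_def by (simp add: card_image card_cartesian_product)
  qed
  have "Y \<subseteq> W \<rightarrow>\<^sub>E V'" unfolding Y_def WW(1) PiE_insert_eq using Y'(1) by blast
  also have "\<dots> \<subseteq> W \<rightarrow>\<^sub>E V" by (rule PiE_mono) (auto simp: V'_def)
  finally have YV: "Y \<subseteq> W \<rightarrow>\<^sub>E V" .
  have good: "short_cycles (F \<union> (\<lambda>w. {w, y w}) ` W) \<and> (\<forall>w\<in>W. y w \<notin> K w)" if yY: "y \<in> Y" for y
  proof -
    obtain a z where az: "y = z(w0 := a)" "a \<in> V'" "z \<in> Y'" using yY unfolding Y_def by auto
    let ?G = "F \<union> (\<lambda>w. {w, z w}) ` W'"
    have yz: "y w = z w" if "w \<in> W'" for w using that WW(2) az(1) by auto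
    \<comment> \<open>Neither an edge of \<open>F\<close> nor another new edge leaves
      \<open>K w0\<close>: the latter have both ends outside it.\<close>
    have "short_cycles (insert {w0, a} ?G)"
    proof (rule short_cycles_insert_bridge[OF Y'(2)[OF az(3)]])
      show "w0 \<in> K w0" using Suc.prems(4) w0(1) by blast
      show "a \<notin> K w0" using az(2) by (simp add: V'_def)
      fix p q assume pq: "{p, q} \<in> ?G" "p \<in> K w0"
      show "q \<in> K w0"
      proof (cases "{p, q} \<in> F")
        case True
        then show ?thesis using Suc.prems(6)[OF w0(1)] pq(2) by blast
      next
        case False
        then obtain w where w: "w \<in> W'" "{p, q} = {w, z w}" using pq(1) by blast
        have "w \<notin> K w0" using dj[OF w(1)] Suc.prems(4)[of w] w(1) by (auto simp: W'_def)
        moreover have "z w \<notin> K w0" using Y'(1) az(3) w(1) by (force simp: V'_def)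
        ultimately show ?thesis using w(2) pq(2) by (auto simp: doubleton_eq_iff)
      qed
    qed
    moreover have "F \<union> (\<lambda>w. {w, y w}) ` W = insert {w0, a} ?G"
      using yz az(1) unfolding WW(1) by auto
    moreover have "y w \<notin> K w" if wW: "w \<in> W" for w
      using wW yz Y'(3)[OF az(3)] az(1,2) unfolding WW(1) by (cases "w = w0") (auto simp: V'_def)
    ultimately show ?thesis by simp
  qed
  let ?n = "real (card V)" and ?n' = "real (card V')"
  have cW: "card W' = m" "card W = Suc m" using Suc.hyps(2) Suc.prems(3) w0(1) by (simp_all add: W'_def)
  \<comment> \<open>The smallest of \<open>m + 1\<close> disjoint sets has at most
    \<open>card V / (m + 1)\<close> elements, so a share of at least \<open>m / (m + 1)\<close> of
    the vertices remains.\<close>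
  have n': "?n * m \<le> ?n' * Suc m"
  proof -
    have "k \<le> card V" using kn by (metis le_trans mult_Suc le_add1)
    then have nk: "?n' = ?n - k" using cV' by (simp add: of_nat_diff)
    have "real (Suc m * k) \<le> ?n" using kn by (rule of_nat_mono)
    moreover have "?n' * Suc m = ?n * m + (?n - real (Suc m * k))" unfolding nk by (simp add: algebra_simps)
    ultimately show ?thesis by linarith
  qed
  have mm: "0 < real m ^ m" by (cases "m = 0") auto
  have "(?n ^ m * fact m) * real m ^ m = (?n * m) ^ m * fact m"
    by (simp add: power_mult_distrib mult_ac)
  also have "\<dots> \<le> (?n' * Suc m) ^ m * fact m"
    using n' by (intro mult_right_mono power_mono) auto
  also have "\<dots> = (?n' ^ m * fact m) * real (Suc m) ^ m"
    by (simp only: power_mult_distrib mult_ac)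
  also have "\<dots> \<le> (card Y' * real m ^ m * ?n') * real (Suc m) ^ m"
    using Y'(4) unfolding cW by (intro mult_right_mono) auto
  also have "\<dots> = (card Y * real (Suc m) ^ m) * real m ^ m"
    unfolding cY of_nat_mult by (simp only: mult_ac)
  finally have "?n ^ m * fact m \<le> card Y * real (Suc m) ^ m" using mm by (rule mult_right_le_imp_le)
  then have "(?n ^ m * fact m) * (Suc m * ?n) \<le> (card Y * real (Suc m) ^ m) * (Suc m * ?n)"
    by (rule mult_right_mono) simp
  then have "?n ^ Suc m * fact (Suc m) \<le> card Y * real (Suc m) ^ Suc m * ?n"
    by (simp only: power_Suc fact_Suc mult_ac)
  then show ?case using YV good unfolding cW by (intro exI[of _ Y]) blast
qed

section \<open>The class as edge sets, and the data that undo a switching\<close>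

definition short_cycle_graphs :: "'a set \<Rightarrow> 'a set set set" where
  "short_cycle_graphs V = {E. (\<forall>e\<in>E. e \<subseteq> V \<and> card e = 2) \<and> short_cycles E}"

definition star_slice :: "'a set \<Rightarrow> 'a \<Rightarrow> nat \<Rightarrow> nat \<Rightarrow> 'a set set set" where
  "star_slice V v D N =
     {E \<in> short_cycle_graphs V. D \<le> card {x. {v, x} \<in> E} \<and> card (loop_verts E v) = N}"

text \<open>What has to be guessed to find the new edges in a switched graph \<open>E\<close>:
  \<open>N\<close> edges, each oriented from the detached vertex to its new neighbour.\<close>

definition arc_choices :: "'a set \<Rightarrow> 'a set set \<Rightarrow> nat \<Rightarrow> ('a set \<times> ('a \<Rightarrow> 'a)) set" where
  "arc_choices V E N = {(W, y). W \<subseteq> V \<and> card W = N \<and> y \<in> W \<rightarrow>\<^sub>E V \<and> (\<forall>w\<in>W. {w, y w} \<in> E)}"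

lemma finite_short_cycle_graphs: "finite V \<Longrightarrow> finite (short_cycle_graphs V)"
  by (rule finite_subset[of _ "Pow (Pow V)"]) (auto simp: short_cycle_graphs_def)

lemma finite_arc_choices: "finite V \<Longrightarrow> finite (arc_choices V E N)"
  by (rule finite_subset[of _ "Sigma (Pow V) (\<lambda>W. W \<rightarrow>\<^sub>E V)"])
    (auto simp: arc_choices_def intro!: finite_SigmaI finite_PiE intro: finite_subset)

text \<open>A choice amounts to \<open>N\<close> of the oriented edges, of which there are at most
  twice \<open>5 * card V\<close>.\<close>

lemma card_arc_choices:
  assumes V: "finite V" and E: "E \<in> short_cycle_graphs V"
  shows "card (arc_choices V E N) * fact N \<le> (10 * card V) ^ N"
proof -
  define A where "A = {(a, b). {a, b} \<in> E}"
  have fE: "finite E" "card E \<le> 5 * card V"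
    using card_edges_le[OF V, of E] E by (auto simp: short_cycle_graphs_def)
  have "A = (\<Union>e\<in>E. {(a, b). {a, b} = e})" by (auto simp: A_def)
  moreover have fin2: "finite {(a, b). {a, b} = e} \<and> card {(a, b). {a, b} = e} \<le> 2" if "e \<in> E" for e
  proof -
    have "card e = 2" using E that by (simp add: short_cycle_graphs_def)
    then obtain x y where "e = {x, y}" by (meson card_2_iff)
    then have sub: "{(a, b). {a, b} = e} \<subseteq> {(x, y), (y, x)}" by (auto simp: doubleton_eq_iff)
    have "card {(x, y), (y, x)} \<le> 2" using card_length[of "[(x, y), (y, x)]"] by simp
    moreover have "card {(a, b). {a, b} = e} \<le> card {(x, y), (y, x)}" using sub by (rule card_mono[rotated]) simp
    moreover have "finite {(a, b). {a, b} = e}" using sub by (rule finite_subset) simp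
    ultimately show ?thesis by linarith
  qed
  ultimately have fA: "finite A" and "card A \<le> (\<Sum>e\<in>E. card {(a, b). {a, b} = e})"
    using fE(1) by (auto intro: card_UN_le)
  then have "card A \<le> (\<Sum>e\<in>E. 2)" using fin2 by (meson order.trans sum_mono)
  then have cA: "card A \<le> 10 * card V" using fE(2) by simp
  let ?f = "\<lambda>(W, y). (\<lambda>w. (w, y w)) ` W"
  have inj: "inj_on ?f (arc_choices V E N)"
  proof (rule inj_onI)
    fix p q assume pq: "p \<in> arc_choices V E N" "q \<in> arc_choices V E N" "?f p = ?f q"
    obtain W y where p: "p = (W, y)" by (cases p)
    obtain X z where q: "q = (X, z)" by (cases q)
    have eq: "(\<lambda>w. (w, y w)) ` W = (\<lambda>w. (w, z w)) ` X" using pq(3) p q by simp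
    have WX: "W = X" using arg_cong[OF eq, of "image fst"] by (simp add: image_image)
    have "y w = z w" if "w \<in> W" for w
    proof -
      have "(w, y w) \<in> (\<lambda>w. (w, z w)) ` X" using eq that by blast
      then show ?thesis by auto
    qed
    moreover have "y \<in> W \<rightarrow>\<^sub>E V" "z \<in> W \<rightarrow>\<^sub>E V" using pq(1,2) p q WX by (auto simp: arc_choices_def)
    ultimately have "y = z" by (metis PiE_ext)
    then show "p = q" using p q WX by simp
  qed
  have "?f ` arc_choices V E N \<subseteq> {B. B \<subseteq> A \<and> card B = N}"
  proof
    fix B assume "B \<in> ?f ` arc_choices V E N"
    then obtain W y where "B = (\<lambda>w. (w, y w)) ` W" "card W = N" "\<forall>w\<in>W. {w, y w} \<in> E"
      by (auto simp: arc_choices_def)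
    then show "B \<in> {B. B \<subseteq> A \<and> card B = N}"
      by (auto simp: A_def card_image inj_on_def)
  qed
  then have "card (arc_choices V E N) \<le> card {B. B \<subseteq> A \<and> card B = N}"
    using fA by (intro card_inj_on_le[OF inj]) auto
  also have "\<dots> = card A choose N" using fA by (rule n_subsets)
  finally have "card (arc_choices V E N) * fact N \<le> (card A choose N) * fact N" by simp
  also have "\<dots> \<le> card A ^ N" by (rule binomial_fact_pow)
  also have "\<dots> \<le> (10 * card V) ^ N" using cA by (rule power_mono) simp
  finally show ?thesis .
qed

lemma loop_verts_subset:
  assumes "E \<in> short_cycle_graphs V" shows "loop_verts E v \<subseteq> V"
proof
  fix x assume "x \<in> loop_verts E v"
  then obtain p where p: "loop_at E v p" "x \<in> set p" by (rule loop_vertsE)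
  have "\<exists>e\<in>E. x \<in> e"
  proof -
    obtain a b where ab: "p = a @ x # b" using p(2) by (meson split_list)
    show ?thesis
    proof (cases b)
      case Nil
      then show ?thesis using p(1) ab by (auto simp: loop_at_def)
    next
      case (Cons z c)
      then have "{x, z} \<in> E" using p(1) ab by (auto simp: loop_at_def gpath_append gpath_Cons)
      then show ?thesis by blast
    qed
  qed
  then show "x \<in> V" using assms by (auto simp: short_cycle_graphs_def)
qed

text \<open>A marked path closes through \<open>v\<close> to a cycle, so it has at most five
  vertices. The bound 55 for arbitrary paths is rounded up to the even number 56.\<close>

lemma block_edges_in_star_graphs:
  assumes E: "E \<in> short_cycle_graphs V" and D: "D \<le> card {x. {v, x} \<in> E}"
  shows "block_edges E v \<in> star_graphs v (loop_verts E v) D"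
proof -
  let ?W = "loop_verts E v" and ?T = "block_edges E v"
  have TE: "?T \<subseteq> E" by (auto simp: block_edges_def)
  have E2: "e \<subseteq> V" "card e = 2" if "e \<in> E" for e using E that by (auto simp: short_cycle_graphs_def)
  have sc: "short_cycles E" using E by (simp add: short_cycle_graphs_def)
  have nv: "x \<in> ?W" if "{v, x} \<in> E" for x
    using neighbour_in_loop_verts[OF that] E2(2)[OF that] by (cases "x = v") auto
  have X: "{x. {v, x} \<in> ?T} = {x. {v, x} \<in> E}" using nv by (auto simp: block_edges_def)
  have "mpaths_le ?T ?W {x. {v, x} \<in> ?T} 5"
    unfolding mpaths_le_def X
  proof (intro allI impI, elim conjE)
    fix p assume p: "gpath ?T p" "p \<noteq> []" "set p \<subseteq> ?W" "hd p \<in> {x. {v, x} \<in> E}" "last p \<in> {x. {v, x} \<in> E}"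
    then have "loop_at E v p"
      using gpath_mono[OF p(1) TE] not_in_loop_verts[of v E] by (auto simp: loop_at_def)
    then show "length p \<le> 5" by (rule loop_at_length[OF sc])
  qed
  moreover have "mpaths_le ?T ?W UNIV 56"
    unfolding mpaths_le_def
  proof (intro allI impI, elim conjE)
    fix p assume p: "gpath ?T p" "set p \<subseteq> ?W"
    then have "length p \<le> 55" using path_in_loop_verts_length[OF sc gpath_mono[OF p(1) TE] p(2)] by simp
    then show "length p \<le> 56" by simp
  qed
  ultimately show ?thesis
    using D E2(2) X by (auto simp: star_graphs_def block_edges_def)
qed

text \<open>\<open>many_attachments\<close> is applied to the components of \<open>F\<close>, which
  separate the vertices of \<open>insert v W\<close>. A new edge joins different components of
  \<open>F\<close>, so it is not in \<open>F\<close> and can be deleted again without loss.\<close>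

lemma block_attachments:
  assumes V: "finite V" "v \<in> V" and E: "E \<in> short_cycle_graphs V"
  defines "W \<equiv> loop_verts E v" and "F \<equiv> E - block_edges E v"
  shows "\<exists>Y \<subseteq> W \<rightarrow>\<^sub>E V. (\<forall>y\<in>Y. F \<union> (\<lambda>w. {w, y w}) ` W \<in> short_cycle_graphs V \<and> F \<inter> (\<lambda>w. {w, y w}) ` W = {}) \<and>
    real (card V) ^ card W * fact (card W) \<le> card Y * real (card W) ^ card W * card V"
proof -
  have WV: "W \<subseteq> V" using E unfolding W_def by (rule loop_verts_subset)
  have E2: "e \<subseteq> V" "card e = 2" if "e \<in> E" for e using E that by (auto simp: short_cycle_graphs_def)
  have sc: "short_cycles F"
    using E unfolding short_cycle_graphs_def F_def by (auto intro: short_cycles_mono)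
  define K where "K w = (restr F UNIV)\<^sup>* `` {w}" for w
  have sep: "x = x'" if "x \<in> insert v W" "x' \<in> insert v W" "(x, x') \<in> (restr F UNIV)\<^sup>*" for x x'
    using outside_block_edges_separated[of x v E x'] that unfolding W_def F_def by blast
  have KV: "K w \<subseteq> V" if wV: "w \<in> V" for w
  proof
    fix z assume "z \<in> K w"
    then have "(w, z) \<in> (restr F UNIV)\<^sup>*" by (simp add: K_def)
    then show "z \<in> V" using wV
    proof (induction rule: rtrancl_induct)
      case (step y z)
      then have "{y, z} \<in> E" by (simp add: restr_def F_def)
      then show ?case using E2(1) by blast
    qed
  qed
  have vW: "v \<notin> W" unfolding W_def by (rule not_in_loop_verts)
  have closed: "b \<in> K w" if ab: "{a, b} \<in> F" "a \<in> K w" for w a b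
  proof -
    have "(a, b) \<in> restr F UNIV" using ab(1) by (simp add: restr_def)
    then show ?thesis using ab(2) by (auto simp: K_def)
  qed
  obtain Y where Y: "Y \<subseteq> W \<rightarrow>\<^sub>E V"
    "\<forall>y\<in>Y. short_cycles (F \<union> (\<lambda>w. {w, y w}) ` W) \<and> (\<forall>w\<in>W. y w \<notin> K w)"
    "real (card V) ^ card W * fact (card W) \<le> card Y * real (card W) ^ card W * card V"
  proof -
    have "\<exists>Y \<subseteq> W \<rightarrow>\<^sub>E V. (\<forall>y\<in>Y. short_cycles (F \<union> (\<lambda>w. {w, y w}) ` W) \<and> (\<forall>w\<in>W. y w \<notin> K w)) \<and>
      real (card V) ^ card W * fact (card W) \<le> card Y * real (card W) ^ card W * card V"
    proof (rule many_attachments[OF V _ _ _ _ sc])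
      show "finite W" using WV V(1) finite_subset by blast
      show "w \<in> K w \<and> K w \<subseteq> V \<and> v \<notin> K w" if wW: "w \<in> W" for w
      proof (intro conjI notI)
        show "w \<in> K w" by (simp add: K_def)
        show "K w \<subseteq> V" using KV WV wW by blast
        assume "v \<in> K w"
        then have "w = v" using sep[of w v] wW by (simp add: K_def)
        then show False using wW vW by simp
      qed
      show "disjoint_family_on K W"
        unfolding disjoint_family_on_def
      proof (intro ballI impI)
        fix w w' assume w: "w \<in> W" "w' \<in> W" "w \<noteq> w'"
        show "K w \<inter> K w' = {}"
        proof (rule ccontr)
          assume "K w \<inter> K w' \<noteq> {}"
          then obtain z where "(w, z) \<in> (restr F UNIV)\<^sup>*" "(w', z) \<in> (restr F UNIV)\<^sup>*" by (auto simp: K_def)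
          then have "(w, w') \<in> (restr F UNIV)\<^sup>*" using restr_rtrancl_sym rtrancl_trans by metis
          then show False using sep[of w w'] w by simp
        qed
      qed
      show "b \<in> K w" if "w \<in> W" "{a, b} \<in> F" "a \<in> K w" for w a b using closed that by blast
    qed
    then show ?thesis using that by blast
  qed
  have "F \<union> (\<lambda>w. {w, y w}) ` W \<in> short_cycle_graphs V \<and> F \<inter> (\<lambda>w. {w, y w}) ` W = {}" if yY: "y \<in> Y" for y
  proof
    have yw: "y w \<notin> K w" "w \<in> K w" "y w \<in> V" "w \<in> V" if wW: "w \<in> W" for w
      using Y(1,2) yY wW WV by (auto simp: K_def)
    have "{w, y w} \<subseteq> V \<and> card {w, y w} = 2" if wW: "w \<in> W" for w
      using yw[OF wW] by (metis card_2_iff empty_subsetI insert_subset)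
    moreover have "e \<subseteq> V \<and> card e = 2" if "e \<in> F" for e using E2[of e] that by (simp add: F_def)
    ultimately have "\<forall>e\<in>F \<union> (\<lambda>w. {w, y w}) ` W. e \<subseteq> V \<and> card e = 2" by blast
    then show "F \<union> (\<lambda>w. {w, y w}) ` W \<in> short_cycle_graphs V"
      using Y(2) yY by (simp add: short_cycle_graphs_def)
    have "{w, y w} \<notin> F" if wW: "w \<in> W" for w using closed[of w "y w" w] yw[OF wW] by blast
    then show "F \<inter> (\<lambda>w. {w, y w}) ` W = {}" by blast
  qed
  then show ?thesis using Y(1,3) by blast
qed

text \<open>The weight per vertex of \<open>W\<close> that pays for all losses: 10 for the oriented
  edges, 3 from \<open>N ^ N \<le> fact N * 3 ^ N\<close>, the rest for the codes of the block
  graphs.\<close>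

definition switch_const :: real where
  "switch_const = 30 * (2 ^ (star_height + 1) * 4)"

lemma finite_star_graphs: "finite W \<Longrightarrow> finite (star_graphs v W D)"
  by (rule finite_subset[of _ "Pow (Pow (insert v W))"]) (auto simp: star_graphs_def)

text \<open>Double counting of pairs of a graph \<open>E\<close> in the slice and an attachment
  \<open>y\<close>. Each \<open>E\<close> has many attachments by \<open>block_attachments\<close>;
  conversely a pair is recovered from the new graph, the choice of the new edges in it, and the
  deleted block edges.\<close>

lemma card_star_slice:
  fixes u :: real
  assumes V: "finite V" "v \<in> V" and u: "1 \<le> u"
  shows "card (star_slice V v D N) * u ^ D \<le>
    card (short_cycle_graphs V) * (card V * star_bound switch_const u)"
proof -
  define A :: real where "A = 2 ^ (star_height + 1) * 4"
  define c where "c = switch_const"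
  let ?sb = "star_bound c u" and ?n = "real (card V)"
  define SL where "SL = star_slice V v D N"
  define AC where "AC E = {(W, y) \<in> arc_choices V E N. v \<notin> W}" for E
  have A1: "1 \<le> A" unfolding A_def by (simp add: one_le_power mult_ge1_I)
  have cA: "c = 3 * (10 * A)" by (simp add: c_def switch_const_def A_def)
  have c1: "1 \<le> c" using A1 cA by simp
  have n1: "1 \<le> ?n" using V by (metis One_nat_def Suc_leI card_gt_0_iff empty_iff of_nat_1 of_nat_mono)
  have sb0: "0 \<le> ?sb" using c1 by (simp add: star_bound_def)
  have SLV: "E \<in> short_cycle_graphs V" "D \<le> card {x. {v, x} \<in> E}" "card (loop_verts E v) = N"
    if "E \<in> SL" for E using that by (auto simp: SL_def star_slice_def)
  have finSL: "finite SL"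
    using finite_subset[OF _ finite_short_cycle_graphs[OF V(1)]] SLV(1) by blast
  let ?F = "\<lambda>E. E - block_edges E v" and ?W = "\<lambda>E. loop_verts E v"
  let ?at = "\<lambda>E y. (\<lambda>w. {w, y w}) ` loop_verts E v"
  have "\<forall>E. \<exists>Y. E \<in> SL \<longrightarrow> Y \<subseteq> ?W E \<rightarrow>\<^sub>E V \<and>
    (\<forall>y\<in>Y. ?F E \<union> ?at E y \<in> short_cycle_graphs V \<and> ?F E \<inter> ?at E y = {}) \<and>
    ?n ^ card (?W E) * fact (card (?W E)) \<le> card Y * real (card (?W E)) ^ card (?W E) * ?n"
  proof
    fix E
    show "\<exists>Y. E \<in> SL \<longrightarrow> Y \<subseteq> ?W E \<rightarrow>\<^sub>E V \<and>
      (\<forall>y\<in>Y. ?F E \<union> ?at E y \<in> short_cycle_graphs V \<and> ?F E \<inter> ?at E y = {}) \<and>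
      ?n ^ card (?W E) * fact (card (?W E)) \<le> card Y * real (card (?W E)) ^ card (?W E) * ?n"
    proof (cases "E \<in> SL")
      case True
      from block_attachments[OF V SLV(1)[OF True]] show ?thesis
        by (rule exE) (rule exI, rule impI, assumption)
    qed simp
  qed
  from choice[OF this] obtain Y where Y: "\<forall>E. E \<in> SL \<longrightarrow> Y E \<subseteq> ?W E \<rightarrow>\<^sub>E V \<and>
    (\<forall>y\<in>Y E. ?F E \<union> ?at E y \<in> short_cycle_graphs V \<and> ?F E \<inter> ?at E y = {}) \<and>
    ?n ^ card (?W E) * fact (card (?W E)) \<le> card (Y E) * real (card (?W E)) ^ card (?W E) * ?n" ..
  have Y1: "Y E \<subseteq> ?W E \<rightarrow>\<^sub>E V" if "E \<in> SL" for E using Y[rule_format, OF that] by simp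
  have Y2: "?F E \<union> ?at E y \<in> short_cycle_graphs V" "?F E \<inter> ?at E y = {}" if "E \<in> SL" "y \<in> Y E" for E y
    using Y[rule_format, OF that(1), THEN conjunct2, THEN conjunct1, rule_format, OF that(2)] by simp_all
  have Y3: "?n ^ N * fact N \<le> card (Y E) * real N ^ N * ?n" if "E \<in> SL" for E
    using Y[rule_format, OF that] SLV(3)[OF that] by simp
  have WV: "?W E \<subseteq> V" if "E \<in> SL" for E using loop_verts_subset[OF SLV(1)[OF that]] .
  have finY: "finite (Y E)" if "E \<in> SL" for E
    using Y1[OF that] finite_subset[OF WV[OF that] V(1)] V(1) by (meson finite_PiE finite_subset)
  define Z where "Z = Sigma SL Y"
  define code where "code = (\<lambda>(E, y). (?F E \<union> ?at E y, (?W E, y), block_edges E v))"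
  define Tgt where "Tgt = Sigma (short_cycle_graphs V) (\<lambda>E. Sigma (AC E) (\<lambda>(W, y). star_graphs v W D))"
  have finW: "finite W" if "(W, y) \<in> AC E" for W y E
    using that V(1) by (auto simp: AC_def arc_choices_def intro: finite_subset)
  have finAC: "finite (AC E)" for E
    by (rule finite_subset[OF _ finite_arc_choices[OF V(1), of E N]]) (auto simp: AC_def)
  have finTgt: "finite Tgt" unfolding Tgt_def
    using finite_short_cycle_graphs[OF V(1)] finAC finW
    by (intro finite_SigmaI) (auto intro!: finite_star_graphs)
  have inj: "inj_on code Z"
  proof (rule inj_onI)
    fix p q assume pq: "p \<in> Z" "q \<in> Z" "code p = code q"
    obtain E y where p: "p = (E, y)" by (cases p)
    obtain E' y' where q: "q = (E', y')" by (cases q)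
    have E: "E \<in> SL" "y \<in> Y E" "E' \<in> SL" "y' \<in> Y E'" using pq(1,2) p q by (auto simp: Z_def)
    have eq: "?F E \<union> ?at E y = ?F E' \<union> ?at E' y'" "?W E = ?W E'" "y = y'" "block_edges E v = block_edges E' v"
      using pq(3) p q by (auto simp: code_def)
    \<comment> \<open>Deleting the new edges, which are disjoint from the retained ones, and
      restoring the block edges gives back \<open>E\<close>.\<close>
    have rec: "E = (?F E \<union> ?at E y - ?at E y) \<union> block_edges E v" if "E \<in> SL" "y \<in> Y E" for E y
    proof -
      have "block_edges E v \<subseteq> E" by (auto simp: block_edges_def)
      then show ?thesis using Y2(2)[OF that] by blast
    qed
    have "E = E'" using rec[OF E(1,2)] rec[OF E(3,4)] eq by simp
    then show "p = q" using p q eq(3) by simp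
  qed
  have "code ` Z \<subseteq> Tgt"
  proof
    fix t assume "t \<in> code ` Z"
    then obtain E y where Ey: "E \<in> SL" "y \<in> Y E" "t = (?F E \<union> ?at E y, (?W E, y), block_edges E v)"
      by (auto simp: Z_def code_def)
    have "(?W E, y) \<in> AC (?F E \<union> ?at E y)"
      using Y1[OF Ey(1)] Ey(2) WV[OF Ey(1)] SLV(3)[OF Ey(1)] not_in_loop_verts[of v E]
      by (auto simp: AC_def arc_choices_def)
    then show "t \<in> Tgt"
      using Y2(1)[OF Ey(1,2)] block_edges_in_star_graphs[OF SLV(1,2)[OF Ey(1)]] Ey(3)
      unfolding Tgt_def by blast
  qed
  then have cZ: "card Z \<le> card Tgt" using inj finTgt by (intro card_inj_on_le) auto
  have cTgt: "card Tgt = (\<Sum>E\<in>short_cycle_graphs V. \<Sum>(W, y)\<in>AC E. card (star_graphs v W D))"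
  proof -
    have fs: "finite (case p of (W, y) \<Rightarrow> star_graphs v W D)" if "p \<in> AC E" for p E
      using that by (cases p) (auto intro!: finite_star_graphs intro: finW[of _ _ E])
    have "card (Sigma (AC E) (\<lambda>(W, y). star_graphs v W D)) = (\<Sum>(W, y)\<in>AC E. card (star_graphs v W D))" for E
      using card_SigmaI[OF finAC, of E "\<lambda>(W, y). star_graphs v W D"] fs by (simp add: case_prod_unfold)
    moreover have "finite (Sigma (AC E) (\<lambda>(W, y). star_graphs v W D))" for E
      using finAC fs by (intro finite_SigmaI) auto
    ultimately show ?thesis
      unfolding Tgt_def using finite_short_cycle_graphs[OF V(1)] by (subst card_SigmaI) auto
  qed
  have star: "real (card (star_graphs v W D)) * (c ^ N * u ^ D) \<le> ?sb * A ^ N * fact N"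
    if Wy: "(W, y) \<in> AC E" for W y E
  proof -
    have "finite W" "v \<notin> W" "card W = N"
      using finW[OF Wy] Wy by (auto simp: AC_def arc_choices_def)
    then show ?thesis using card_star_graphs[OF c1 u, of W v D] unfolding A_def by simp
  qed
  have inner: "(\<Sum>(W, y)\<in>AC E. real (card (star_graphs v W D))) * (c ^ N * u ^ D) \<le> (10 * ?n) ^ N * (?sb * A ^ N)"
    if E: "E \<in> short_cycle_graphs V" for E
  proof -
    have "(\<Sum>(W, y)\<in>AC E. real (card (star_graphs v W D))) * (c ^ N * u ^ D) =
        (\<Sum>(W, y)\<in>AC E. real (card (star_graphs v W D)) * (c ^ N * u ^ D))"
      by (simp add: sum_distrib_right case_prod_unfold)
    also have "\<dots> \<le> (\<Sum>(W, y)\<in>AC E. ?sb * A ^ N * fact N)"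
      using star by (intro sum_mono) auto
    also have "\<dots> = card (AC E) * fact N * (?sb * A ^ N)" by simp
    also have "\<dots> \<le> (10 * ?n) ^ N * (?sb * A ^ N)"
    proof (rule mult_right_mono)
      have "card (AC E) \<le> card (arc_choices V E N)"
        by (rule card_mono[OF finite_arc_choices[OF V(1)]]) (auto simp: AC_def)
      then have "card (AC E) * fact N \<le> card (arc_choices V E N) * fact N" by simp
      also have "\<dots> \<le> (10 * card V) ^ N" by (rule card_arc_choices[OF V(1) E])
      finally have "real (card (AC E) * fact N) \<le> real ((10 * card V) ^ N)" by (rule of_nat_mono)
      then show "card (AC E) * fact N \<le> (10 * ?n) ^ N" by simp
    qed (use sb0 A1 in simp)
    finally show ?thesis .
  qed
  let ?ex = "real (card (short_cycle_graphs V))"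
  have Zb: "card Z * (c ^ N * u ^ D) \<le> ?ex * ((10 * ?n) ^ N * (?sb * A ^ N))"
  proof -
    have "card Z * (c ^ N * u ^ D) \<le> card Tgt * (c ^ N * u ^ D)"
      using cZ c1 u by (intro mult_right_mono) auto
    also have "\<dots> = (\<Sum>E\<in>short_cycle_graphs V. (\<Sum>(W, y)\<in>AC E. real (card (star_graphs v W D))) * (c ^ N * u ^ D))"
      unfolding cTgt by (simp add: sum_distrib_right case_prod_unfold)
    also have "\<dots> \<le> (\<Sum>E\<in>short_cycle_graphs V. (10 * ?n) ^ N * (?sb * A ^ N))"
      by (intro sum_mono inner)
    finally show ?thesis by simp
  qed
  have "card SL * (?n ^ N * fact N) = (\<Sum>E\<in>SL. ?n ^ N * fact N)" by simp
  also have "\<dots> \<le> (\<Sum>E\<in>SL. card (Y E) * real N ^ N * ?n)" by (intro sum_mono Y3)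
  also have "\<dots> = card Z * (real N ^ N * ?n)"
    unfolding Z_def using finSL finY by (simp add: card_SigmaI sum_distrib_right mult.assoc)
  finally have SZ: "card SL * (?n ^ N * fact N) \<le> card Z * (real N ^ N * ?n)" .
  have NN: "real N ^ N \<le> fact N * 3 ^ N"
  proof -
    have "real N ^ N / fact N \<le> exp (real N)" by (rule power_div_fact_le_exp) simp
    also have "exp (real N) = exp 1 ^ N" by (simp flip: exp_of_nat_mult)
    also have "\<dots> \<le> 3 ^ N" using exp_le by (intro power_mono) auto
    finally show ?thesis by (simp add: divide_le_eq mult.commute)
  qed
  \<comment> \<open>By the choice of \<open>c\<close>, the powers and factorials in \<open>N\<close>
    agree on both sides and cancel.\<close>
  let ?q = "?n ^ N * fact N * (3 * (10 * A)) ^ N"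
  have q0: "0 < ?q" using n1 A1 by simp
  have "card SL * u ^ D * ?q = card SL * (?n ^ N * fact N) * (c ^ N * u ^ D)"
    unfolding cA by (simp only: mult_ac)
  also have "\<dots> \<le> card Z * (real N ^ N * ?n) * (c ^ N * u ^ D)"
    using SZ c1 u by (intro mult_right_mono) auto
  also have "\<dots> = card Z * (c ^ N * u ^ D) * (real N ^ N * ?n)" by (simp only: mult_ac)
  also have "\<dots> \<le> ?ex * ((10 * ?n) ^ N * (?sb * A ^ N)) * (real N ^ N * ?n)"
    using Zb by (intro mult_right_mono) auto
  also have "\<dots> \<le> ?ex * ((10 * ?n) ^ N * (?sb * A ^ N)) * ((fact N * 3 ^ N) * ?n)"
    using NN sb0 A1 by (intro mult_left_mono mult_right_mono) auto
  also have "\<dots> = ?ex * (?n * ?sb) * ?q"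
    by (simp only: power_mult_distrib mult_ac)
  finally have "card SL * u ^ D \<le> ?ex * (?n * ?sb)" using q0 by (rule mult_right_le_imp_le)
  then show ?thesis by (simp add: SL_def c_def)
qed

text \<open>Union bound over the vertex \<open>v\<close> and the number \<open>N\<close> of loop
  vertices: \<open>n * (n + 1)\<close> slices for \<open>n\<close> vertices, each with another
  factor \<open>n\<close>.\<close>

lemma card_large_degree:
  fixes u :: real
  assumes V: "finite V" and u: "1 \<le> u"
  shows "card {E \<in> short_cycle_graphs V. \<exists>v\<in>V. D \<le> card {x. {v, x} \<in> E}} * u ^ D \<le>
    card (short_cycle_graphs V) * (real (card V) ^ 2 * (card V + 1) * star_bound switch_const u)"
proof -
  let ?B = "{E \<in> short_cycle_graphs V. \<exists>v\<in>V. D \<le> card {x. {v, x} \<in> E}}"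
  let ?M = "card (short_cycle_graphs V) * (card V * star_bound switch_const u)"
  have sub: "?B \<subseteq> (\<Union>(v, N)\<in>V \<times> {..card V}. star_slice V v D N)"
  proof
    fix E assume "E \<in> ?B"
    then obtain v where v: "E \<in> short_cycle_graphs V" "v \<in> V" "D \<le> card {x. {v, x} \<in> E}" by blast
    have "card (loop_verts E v) \<le> card V" using V loop_verts_subset[OF v(1)] by (intro card_mono) auto
    then show "E \<in> (\<Union>(v, N)\<in>V \<times> {..card V}. star_slice V v D N)"
      using v by (auto simp: star_slice_def intro!: bexI[of _ "(v, card (loop_verts E v))"])
  qed
  have fin: "finite (star_slice V v D N)" for v N
    by (rule finite_subset[OF _ finite_short_cycle_graphs[OF V]]) (auto simp: star_slice_def)
  have "card ?B \<le> card (\<Union>(v, N)\<in>V \<times> {..card V}. star_slice V v D N)"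
    using V fin sub by (intro card_mono) auto
  also have "\<dots> \<le> (\<Sum>(v, N)\<in>V \<times> {..card V}. card (star_slice V v D N))"
    using V by (auto intro: order.trans[OF card_UN_le] simp: case_prod_unfold)
  finally have "real (card ?B) * u ^ D \<le> real (\<Sum>(v, N)\<in>V \<times> {..card V}. card (star_slice V v D N)) * u ^ D"
    using u by (intro mult_right_mono of_nat_mono) auto
  also have "\<dots> = (\<Sum>(v, N)\<in>V \<times> {..card V}. card (star_slice V v D N) * u ^ D)"
    by (simp add: sum_distrib_right case_prod_unfold)
  also have "\<dots> \<le> (\<Sum>(v, N)\<in>V \<times> {..card V}. ?M)"
    using card_star_slice[OF V _ u] by (intro sum_mono) auto
  also have "\<dots> = card (short_cycle_graphs V) * (real (card V) ^ 2 * (card V + 1) * star_bound switch_const u)"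
    using V by (simp add: card_cartesian_product power2_eq_square algebra_simps)
  finally show ?thesis .
qed

section \<open>Maximum degree\<close>

lemma excluded_minor_graphs_eq:
  "excluded_minor_graphs (cycle_graph 7) n = Pair {1..n} ` short_cycle_graphs {1..n}"
proof
  show "excluded_minor_graphs (cycle_graph 7) n \<subseteq> Pair {1..n} ` short_cycle_graphs {1..n}"
  proof
    fix G assume G: "G \<in> excluded_minor_graphs (cycle_graph 7) n"
    obtain V E where VE: "G = (V, E)" by (cases G)
    have *: "simple_graph (V, E)" "V = {1..n}" "\<not> is_minor (cycle_graph 7) (V, E)"
      using G VE by (auto simp: excluded_minor_graphs_def)
    have "short_cycles E" by (rule not_minor_imp_short_cycles[OF *(1,3)])
    then have "E \<in> short_cycle_graphs {1..n}"
      using *(1,2) by (simp add: short_cycle_graphs_def simple_graph_def)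
    then show "G \<in> Pair {1..n} ` short_cycle_graphs {1..n}" using VE *(2) by blast
  qed
  show "Pair {1..n} ` short_cycle_graphs {1..n} \<subseteq> excluded_minor_graphs (cycle_graph 7) n"
  proof (rule image_subsetI)
    fix E assume E: "E \<in> short_cycle_graphs {1..n}"
    then have "\<not> is_minor (cycle_graph 7) ({1..n}, E)"
      by (intro short_cycles_imp_not_minor) (simp add: short_cycle_graphs_def)
    then show "({1..n}, E) \<in> excluded_minor_graphs (cycle_graph 7) n"
      using E by (simp add: excluded_minor_graphs_def short_cycle_graphs_def simple_graph_def)
  qed
qed

lemma prob_large_degree_le:
  fixes t u :: real
  assumes n: "1 \<le> n" and u: "1 \<le> u"
  shows "1 - measure_pmf.prob (pmf_of_set (excluded_minor_graphs (cycle_graph 7) n)) {G. real (max_degree G) \<le> t}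
    \<le> real n ^ 2 * (n + 1) * star_bound switch_const u * u powr (- t)"
proof -
  let ?S = "excluded_minor_graphs (cycle_graph 7) n" and ?H = "short_cycle_graphs {1..n}"
  let ?A = "{G. real (max_degree G) \<le> t}"
  \<comment> \<open>A degree above \<open>t\<close> is at least \<open>D\<close>, and
    \<open>u ^ D\<close> is at least \<open>u powr t\<close>.\<close>
  define D where "D = nat \<lceil>t\<rceil>"
  define B where "B = {E \<in> ?H. \<exists>v\<in>{1..n}. D \<le> card {x. {v, x} \<in> E}}"
  have fS: "finite ?S" by (rule finite_excluded_minor_graphs)
  have neS: "?S \<noteq> {}" by (rule excluded_minor_graphs_cycle_nonempty)
  have cS: "card ?S = card ?H"
    unfolding excluded_minor_graphs_eq by (rule card_image) (auto intro: inj_onI)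
  have cpos: "0 < real (card ?S)" using fS neS by (simp add: card_gt_0_iff)
  have "?S - ?A \<subseteq> Pair {1..n} ` B"
  proof
    fix G assume G: "G \<in> ?S - ?A"
    then obtain E where E: "E \<in> ?H" "G = ({1..n}, E)" unfolding excluded_minor_graphs_eq by auto
    have "Max (vertex_degree G ` {1..n}) \<in> vertex_degree G ` {1..n}" by (rule Max_in) (use n in auto)
    then have "max_degree G \<in> vertex_degree G ` {1..n}" by (simp add: max_degree_def E(2))
    then obtain v where v: "v \<in> {1..n}" "max_degree G = vertex_degree G v" by auto
    have "{w \<in> {1..n}. {v, w} \<in> E} = {x. {v, x} \<in> E}"
      using E(1) by (auto simp: short_cycle_graphs_def)
    then have deg: "max_degree G = card {x. {v, x} \<in> E}" using v(2) E(2) by (simp add: vertex_degree_def)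
    have "t < real (max_degree G)" using G by auto
    then have "D \<le> max_degree G" unfolding D_def nat_ceiling_le_eq by simp
    then have "E \<in> B" unfolding B_def deg using E(1) v(1) by blast
    then show "G \<in> Pair {1..n} ` B" unfolding E(2) by (rule imageI)
  qed
  moreover have finB: "finite B"
    by (rule finite_subset[OF _ finite_short_cycle_graphs[of "{1..n}"]]) (auto simp: B_def)
  ultimately have "card (?S - ?A) \<le> card (Pair {1..n} ` B)" by (intro card_mono) auto
  also have "\<dots> \<le> card B" using finB by (rule card_image_le)
  finally have cB: "card (?S - ?A) \<le> card B" .
  have "card (?S - ?A) + card (?S \<inter> ?A) = card ?S"
    using card_Int_Diff[OF fS, of ?A] by simp
  then have split: "real (card ?S) - real (card (?S \<inter> ?A)) = real (card (?S - ?A))" by linarith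
  have "1 - measure_pmf.prob (pmf_of_set ?S) ?A = (real (card ?S) - real (card (?S \<inter> ?A))) / card ?S"
    using cpos by (simp add: measure_pmf_of_set[OF neS fS] diff_divide_distrib)
  also have "\<dots> = real (card (?S - ?A)) / card ?S" unfolding split ..
  also have "\<dots> \<le> real (card B) / card ?S" using cB cpos by (intro divide_right_mono) auto
  finally have p: "1 - measure_pmf.prob (pmf_of_set ?S) ?A \<le> real (card B) / card ?S" .
  let ?M = "real n ^ 2 * (n + 1) * star_bound switch_const u"
  have uD: "0 < u ^ D" using u by simp
  have "real (card B) * u ^ D \<le> card ?S * ?M"
    using card_large_degree[of "{1..n}" u D] u unfolding cS B_def by simp
  then have "real (card B) / card ?S \<le> ?M / u ^ D"
    using uD cpos by (simp add: divide_simps mult.commute)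
  also have "\<dots> \<le> ?M * u powr (- t)"
  proof -
    have "u powr t \<le> u powr (real D)" using u by (intro powr_mono) (simp_all add: D_def real_nat_ceiling_ge)
    then have "u powr t \<le> u ^ D" using u by (simp add: powr_realpow)
    then have "inverse (u ^ D) \<le> inverse (u powr t)" using u by (intro le_imp_inverse_le) auto
    moreover have "0 \<le> ?M" by (simp add: star_bound_def switch_const_def)
    ultimately show ?thesis
      unfolding powr_minus divide_inverse by (intro mult_left_mono) auto
  qed
  finally show ?thesis using p by linarith
qed


theorem theorem13:
  shows "\<exists>C::real. C > 0 \<and>
    (\<lambda>n::nat. measure_pmf.prob (pmf_of_set (excluded_minor_graphs (cycle_graph 7) n))
       {G. real (max_degree G) \<le> C * (ln (real n) / ln (ln (ln (ln (real n)))))})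
    \<longlonglongrightarrow> 1"
proof -
  define c where "c = switch_const"
  have c0: "0 < c" by (simp add: c_def switch_const_def)
  define a where "a = sep_const 3 * (c * exp (unmarked_bound c 28))"
  define b where "b = real (sep_const 5)"
  have a0: "0 < a" unfolding a_def using c0 sep_const_ge_1[of 3] by simp
  have b0: "0 < b" unfolding b_def using sep_const_ge_1[of 5] by simp
  \<comment> \<open>\<open>u n\<close> solves \<open>star_bound c (u n) = c * n\<close> for large
    \<open>n\<close>; it is of order \<open>ln (ln (ln n))\<close>.\<close>
  define u where "u n = ln (ln (ln (real n)) / b) / a" for n :: nat
  \<comment> \<open>10 is twice 5: \<open>ln (u n)\<close> is bounded below by half of the fourfold
    logarithm, and \<open>u n powr (- t n)\<close> is to be at most \<open>n powr (- 5)\<close>,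
    which beats the remaining factor of order \<open>n ^ 4\<close>.\<close>
  define t where "t n = 10 * (ln (real n) / ln (ln (ln (ln (real n)))))" for n :: nat
  let ?pr = "\<lambda>n. measure_pmf.prob (pmf_of_set (excluded_minor_graphs (cycle_graph 7) n)) {G. real (max_degree G) \<le> t n}"
  have ev1: "eventually (\<lambda>n::nat. 1 \<le> u n) sequentially"
    unfolding u_def using a0 b0 by real_asymp
  have ev2: "eventually (\<lambda>n::nat. ln (ln (ln (ln (real n)))) / 2 \<le> ln (u n)) sequentially"
    unfolding u_def using a0 b0 by real_asymp
  have ev3: "eventually (\<lambda>n::nat. 0 < ln (ln (ln (ln (real n))))) sequentially" by real_asymp
  have ev4: "eventually (\<lambda>n::nat. 0 < ln (ln (real n))) sequentially" by real_asymp
  have ev5: "eventually (\<lambda>n::nat. 0 < ln (real n)) sequentially" by real_asymp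
  have ev6: "eventually (\<lambda>n::nat. 1 \<le> n) sequentially" by (rule eventually_ge_at_top)
  have "eventually (\<lambda>n. 1 - ?pr n \<le> real n ^ 2 * real (n + 1) * (c * real n) * real n powr (- 5)) sequentially"
    using ev1 ev2 ev3 ev4 ev5 ev6
  proof eventually_elim
    case (elim n)
    have sb: "star_bound c (u n) = c * real n"
    proof -
      have "sep_const 3 * (c * u n * exp (unmarked_bound c 28)) = a * u n" by (simp add: a_def)
      also have "\<dots> = ln (ln (ln (real n)) / b)" using a0 by (simp add: u_def)
      finally have 1: "exp (sep_const 3 * (c * u n * exp (unmarked_bound c 28))) = ln (ln (real n)) / b"
        using elim(4) b0 by (simp only: exp_ln divide_pos_pos)
      have 2: "sep_const 5 * (ln (ln (real n)) / b) = ln (ln (real n))" using b0 by (simp add: b_def)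
      show ?thesis unfolding star_bound_def 1 2 using elim(5,6) by simp
    qed
    have "u n powr (- t n) = exp (- t n * ln (u n))" using elim(1) by (simp add: powr_def)
    also have "\<dots> \<le> exp (- 5 * ln (real n))"
    proof -
      have "5 * ln (real n) = t n * (ln (ln (ln (ln (real n)))) / 2)" using elim(3) by (simp add: t_def)
      also have "\<dots> \<le> t n * ln (u n)"
        using elim(2,3,5) by (intro mult_left_mono) (auto simp: t_def)
      finally show ?thesis by simp
    qed
    also have "\<dots> = real n powr (- 5)" using elim(6) by (simp add: powr_def)
    finally have up: "u n powr (- t n) \<le> real n powr (- 5)" .
    have "1 - ?pr n \<le> real n ^ 2 * (n + 1) * star_bound c (u n) * u n powr (- t n)"
      unfolding c_def by (rule prob_large_degree_le[OF elim(6,1)])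
    also have "\<dots> \<le> real n ^ 2 * (n + 1) * (c * real n) * real n powr (- 5)"
      unfolding sb using up c0 by (intro mult_left_mono) auto
    finally show ?case .
  qed
  then have "eventually (\<lambda>n. 1 - real n ^ 2 * real (n + 1) * (c * real n) * real n powr (- 5) \<le> ?pr n) sequentially"
    by eventually_elim linarith
  moreover have "(\<lambda>n::nat. 1 - real n ^ 2 * real (n + 1) * (c * real n) * real n powr (- 5)) \<longlonglongrightarrow> 1"
    using c0 by real_asymp
  moreover have "eventually (\<lambda>n. ?pr n \<le> 1) sequentially" by simp
  ultimately have "?pr \<longlonglongrightarrow> 1"
    by (intro tendsto_sandwich[of _ ?pr sequentially "\<lambda>_. 1"]) auto
  then show ?thesis unfolding t_def by (intro exI[of _ 10]) simp
qed

end
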